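(* For $n\ge 1$ let $C_n$ denote the number of root isthmic parts in a uniformly random rooted map with $n$ edges (no restriction on genus). Then, as $n\to\infty$, $$C_n\ \overset{d}{\longrightarrow}\ \mathrm{Geometric}\bigl(\tfrac12\bigr),$$ where $\mathrm{Geometric}(\tfrac12)$ is the distribution on $\{1,2,3,\dots\}$ giving mass $2^{-k}$ to each $k\ge1$.
   Context: A map is a connected multigraph (loops and multiple edges allowed) endowed with a cyclic ordering (say counterclockwise) of the half-edges incident to each vertex. Around each vertex, each pair of consecutive half-edges in the cyclic order forms a corner (a vertex with only one half-edge has one corner; a vertex of degree $d\ge1$ has $d$ corners; the one-vertex map with no edge has exactly one corner). A rooted map is a map with a distinguished corner, the root; the vertex at this corner is the root vertex. Rooted maps are considered up to isomorphisms preserving the graph structure, the root corner and the cyclic orderings. "Random rooted map with $n$ edges" means that all rooted maps with $n$ edges are equally likely. An isthmus is an edge whose deletion increases the number of connected components of the underlying graph. Recursive construction of rooted maps. Every rooted map with $n\ge1$ edges is obtained in exactly one way either (i) by connecting the root corners of two rooted maps $M_1,M_2$ (with $n-1$ edges in total) by a new edge, which is an isthmus, the root vertex of the result being that of $M_1$; or (ii) by adding to a rooted map $M_0$ with $n-1$ edges a new edge connecting the root corner to some corner of $M_0$ ($2n-1$ ways, as there are two ways of attaching the other end of the new edge at the root corner itself when $n\ge 2$). In both cases the new root corner is the one immediately preceding, in the cyclic order around the root vertex, the half-edge of the new edge inserted at the old root corner. Equivalently, for a rooted map $M$ with $n\ge1$ edges, let $e$ be the edge containing the half-edge that follows the root corner;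 delete $e$. If $e$ is an isthmus this gives $M_1$ (the component containing the root vertex) and $M_2$, each rooted at the corner left where a half-edge of $e$ was removed; otherwise it gives $M_0$, rooted at the corner left by the removal of the half-edge following the root corner. The number $c(M)$ of root isthmic parts is the number of isthmic constructions (i) used at the root vertex in this recursive construction: $c(M)=0$ if $M$ has no edge; $c(M)=1+c(M_1)$ in case (i); $c(M)=c(M_0)$ in case (ii). $\overset{d}{\longrightarrow}$ is convergence in distribution. *)

theory Defs
  imports "HOL-Probability.Probability"
begin

text \<open>
  A multigraph is given by its vertices and half-edges. The involution \<open>mate\<close> matches the two
  half-edges of each edge (a loop has both halves at the same vertex), and \<open>rot\<close> sends a half-edge
  to the next one in counterclockwise order around its vertex. All functions are relevant on
  \<open>half_edges\<close> only. Vertices are kept explicit so that deleting an edge may leave an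
  isolated vertex.
\<close>

record ('v, 'h) cmap =
  verts :: "'v set"
  half_edges :: "'h set"
  vert_of :: "'h \<Rightarrow> 'v"
  mate :: "'h \<Rightarrow> 'h"
  rot :: "'h \<Rightarrow> 'h"

definition edges :: "('v, 'h, 'z) cmap_scheme \<Rightarrow> 'h set set" where
  "edges M = (\<lambda>h. {h, mate M h}) ` half_edges M"

definition adj :: "('v, 'h, 'z) cmap_scheme \<Rightarrow> ('v \<times> 'v) set" where
  "adj M = {(vert_of M h, vert_of M (mate M h)) | h. h \<in> half_edges M}"

definition conn_components :: "('v, 'h, 'z) cmap_scheme \<Rightarrow> 'v set set" where
  "conn_components M = verts M // ((adj M)\<^sup>* \<inter> verts M \<times> verts M)"

definition is_cmap :: "('v, 'h, 'z) cmap_scheme \<Rightarrow> bool" where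
  "is_cmap M \<longleftrightarrow>
     finite (verts M) \<and> finite (half_edges M) \<and>
     (\<forall>h\<in>half_edges M. vert_of M h \<in> verts M) \<and>
     (\<forall>h\<in>half_edges M. mate M h \<in> half_edges M \<and> mate M h \<noteq> h \<and> mate M (mate M h) = h) \<and>
     bij_betw (rot M) (half_edges M) (half_edges M) \<and>
     (\<forall>h\<in>half_edges M. \<forall>h'\<in>half_edges M.
        vert_of M h = vert_of M h' \<longleftrightarrow> (\<exists>k. (rot M ^^ k) h = h')) \<and>
     card (conn_components M) = 1"

text \<open>
  \<open>Before h\<close> is the corner immediately preceding the half-edge \<open>h\<close>, that is, the one between the
  predecessor of \<open>h\<close> under \<open>rot\<close> and \<open>h\<close> itself; \<open>Bare v\<close> is the single corner of a vertex \<open>v\<close> with no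
  half-edge.
\<close>

datatype ('v, 'h) corner = Bare 'v | Before 'h

definition corners :: "('v, 'h, 'z) cmap_scheme \<Rightarrow> ('v, 'h) corner set" where
  "corners M = Before ` half_edges M \<union> Bare ` (verts M - vert_of M ` half_edges M)"

record ('v, 'h) rooted_cmap = "('v, 'h) cmap" +
  root_corner :: "('v, 'h) corner"

definition is_rooted_cmap :: "('v, 'h) rooted_cmap \<Rightarrow> bool" where
  "is_rooted_cmap M \<longleftrightarrow> is_cmap M \<and> root_corner M \<in> corners M"

definition rooted_iso :: "('v, 'h) rooted_cmap \<Rightarrow> ('v, 'h) rooted_cmap \<Rightarrow> bool" where
  "rooted_iso M N \<longleftrightarrow>
     (\<exists>f g. bij_betw f (verts M) (verts N) \<and> bij_betw g (half_edges M) (half_edges N) \<and>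
        (\<forall>h\<in>half_edges M.
           vert_of N (g h) = f (vert_of M h) \<and>
           mate N (g h) = g (mate M h) \<and>
           rot N (g h) = g (rot M h)) \<and>
        root_corner N = map_corner f g (root_corner M))"

definition first_return :: "('a \<Rightarrow> 'a) \<Rightarrow> 'a set \<Rightarrow> 'a \<Rightarrow> 'a" where
  "first_return f S x = (f ^^ (LEAST k. 0 < k \<and> (f ^^ k) x \<in> S)) x"

text \<open>Deletion of the edge containing the half-edge \<open>h\<close>; \<open>rot\<close> now skips the removed half-edges.\<close>

definition delete_edge :: "('v, 'h, 'z) cmap_scheme \<Rightarrow> 'h \<Rightarrow> ('v, 'h, 'z) cmap_scheme" where
  "delete_edge M h =
     M\<lparr>half_edges := half_edges M - {h, mate M h},
       rot := first_return (rot M) (half_edges M - {h, mate M h})\<rparr>"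

definition isthmus :: "('v, 'h, 'z) cmap_scheme \<Rightarrow> 'h \<Rightarrow> bool" where
  "isthmus M h \<longleftrightarrow> card (conn_components (delete_edge M h)) > card (conn_components M)"

text \<open>The corner left at the place of \<open>h\<close> once the edge containing \<open>h\<close> has been deleted.\<close>

definition corner_left :: "('v, 'h, 'z) cmap_scheme \<Rightarrow> 'h \<Rightarrow> ('v, 'h) corner" where
  "corner_left M h =
     (let H = half_edges M - {h, mate M h} in
      if vert_of M h \<in> vert_of M ` H then Before (first_return (rot M) H h)
      else Bare (vert_of M h))"

definition delete_root_edge :: "('v, 'h) rooted_cmap \<Rightarrow> 'h \<Rightarrow> ('v, 'h) rooted_cmap" where
  "delete_root_edge M h = (delete_edge M h)\<lparr>root_corner := corner_left M h\<rparr>"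

definition component_of :: "('v, 'h, 'z) cmap_scheme \<Rightarrow> 'v \<Rightarrow> ('v, 'h, 'z) cmap_scheme" where
  "component_of M v =
     M\<lparr>verts := {u \<in> verts M. (v, u) \<in> (adj M)\<^sup>*},
       half_edges := {h \<in> half_edges M. (v, vert_of M h) \<in> (adj M)\<^sup>*}\<rparr>"

text \<open>
  The number of root isthmic parts. The side conditions on \<open>h\<close> hold for every rooted map and only
  ensure termination on ill-formed records.
\<close>

function isthmic_parts :: "('v, 'h) rooted_cmap \<Rightarrow> nat" where
  "isthmic_parts M =
     (case root_corner M of
        Bare v \<Rightarrow> 0
      | Before h \<Rightarrow>
          if finite (half_edges M) \<and> h \<in> half_edges M then
            if isthmus M h
            then 1 + isthmic_parts (component_of (delete_root_edge M h) (vert_of M h))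
            else isthmic_parts (delete_root_edge M h)
          else 0)"
  by auto
termination
proof (relation "Wellfounded.measure (\<lambda>M. card (half_edges M))", goal_cases)
  case (2 M h)
  then have "half_edges (component_of (delete_root_edge M h) (vert_of M h)) \<subseteq> half_edges M - {h}"
    by (auto simp: component_of_def delete_root_edge_def delete_edge_def)
  with 2 show ?case by (auto intro!: psubset_card_mono)
next
  case (3 M h)
  then show ?case
    by (auto simp: delete_root_edge_def delete_edge_def intro!: psubset_card_mono)
qed simp

declare isthmic_parts.simps [simp del]

text \<open>
  Rooted maps are isomorphism classes of rooted maps with vertices and half-edges labelled by
  natural numbers.
\<close>

definition rooted_iso_rel :: "((nat, nat) rooted_cmap \<times> (nat, nat) rooted_cmap) set" where
  "rooted_iso_rel = {(M, N). is_rooted_cmap M \<and> is_rooted_cmap N \<and> rooted_iso M N}"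

definition rooted_maps :: "nat \<Rightarrow> (nat, nat) rooted_cmap set set" where
  "rooted_maps n = {M. is_rooted_cmap M \<and> card (edges M) = n} // rooted_iso_rel"

text \<open>\<open>isthmic_parts\<close> is invariant under isomorphism, so its image on a class is a singleton.\<close>

definition class_isthmic_parts :: "(nat, nat) rooted_cmap set \<Rightarrow> nat" where
  "class_isthmic_parts X = the_elem (isthmic_parts ` X)"

definition random_rooted_map :: "nat \<Rightarrow> (nat, nat) rooted_cmap set pmf" where
  "random_rooted_map n = pmf_of_set (rooted_maps n)"

end

theory Submission
  imports Defs
    "HOL-Computational_Algebra.Formal_Power_Series"
    "HOL-Real_Asymp.Real_Asymp"
    "HOL-Combinatorics.Orbits"
begin

text \<open>
  Put a phantom half-edge \<open>r\<close> into the root corner. A rooted map with labelled half-edges \<open>A\<close> is then a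
  matching \<open>m\<close> of \<open>A\<close> together with a permutation \<open>\<sigma>\<close> of \<open>A \<union> {r}\<close> (the rotations) such that \<open>m\<close> and
  \<open>\<sigma>\<close> act transitively; bare vertices need no special treatment. Cutting the edge \<open>{h, m h}\<close> with
  \<open>h = \<sigma> r\<close> either leaves a connected map, from which \<open>m h\<close> can be removed, or it leaves two maps, the
  second one having \<open>m h\<close> as its phantom root. This gives the recursion for the labelled counts, and
  since rooted maps have no nontrivial automorphisms, every isomorphism class with \<open>n\<close> edges has
  exactly \<open>(2n)!\<close> labellings.

  In the recursion \<open>m\<^sub>n\<^sub>,\<^sub>k = (2n-1) m\<^sub>n\<^sub>-\<^sub>1\<^sub>,\<^sub>k + \<Sum> m\<^sub>i\<^sub>,\<^sub>k\<^sub>-\<^sub>1 m\<^sub>j\<close> (over \<open>i + j = n-1\<close>) the terms with \<open>i, j \<ge> 1\<close> are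
  negligible because \<open>m\<^sub>n\<close> is of the order of \<open>(2n+1)!!\<close>. What remains is a contraction with factor
  \<open>(2n+1)/(2n+3)\<close>, which drives the proportions \<open>p\<^sub>k\<close> to the solution of \<open>2 p\<^sub>k = p\<^sub>k\<^sub>-\<^sub>1 + [k = 1]\<close>.
\<close>

text \<open>The obstacle in the limit is that the contraction factor tends to 1, so vanishing errors
  per step would not suffice by themselves. But each error is also divided by about 2n: weighted
  with 2n+1, the distance to the limit grows by o(1) per step, hence sublinearly. For this the
  middle terms must be o(1) relative to \<open>total_count n\<close>.

  On the side of maps, isthmic parts are defined by successive deletions on records, while
  permutations are what can be counted. The predicate \<open>represents\<close> links the two and is
  loose enough to survive each deletion. The matching stays fixed during the counting: an isthmus
  then splits the remaining edges into two closed sets, and the binomial coefficients of this choice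
  are absorbed by the factor 2^n n!, so that labelled and unlabelled counts obey the same recursion.
  Predicates on c take the place of single values, because both the total number (always true) and
  the shift by an isthmus (composition with \<open>Suc\<close>) are then instances.\<close>

hide_const (open) Finite_Cartesian_Product.transpose

section \<open>Asymptotics of the recursion\<close>

text \<open>
  Counts the rooted maps with \<open>n\<close> edges whose number \<open>c\<close> of root isthmic parts satisfies \<open>P\<close>;
  construction (i) contributes \<open>P \<circ> Suc\<close> because only \<open>M\<^sub>1\<close> is followed.
\<close>

function map_count :: "(nat \<Rightarrow> bool) \<Rightarrow> nat \<Rightarrow> nat" where
  "map_count P 0 = of_bool (P 0)"
| "map_count P (Suc n) = (2 * n + 1) * map_count P n
     + (\<Sum>i\<le>n. map_count (P \<circ> Suc) i * map_count (\<lambda>_. True) (n - i))"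
  by pat_completeness auto
termination by (relation "Wellfounded.measure snd") auto

abbreviation total_count :: "nat \<Rightarrow> nat" where
  "total_count \<equiv> map_count (\<lambda>_. True)"

text \<open>The double factorial (2n-1)!!. Its index is shifted against the size of maps:
  \<open>total_count n\<close> is comparable to \<open>odd_fact (Suc n)\<close>.\<close>

primrec odd_fact :: "nat \<Rightarrow> nat" where
  "odd_fact 0 = 1"
| "odd_fact (Suc n) = (2 * n + 1) * odd_fact n"

lemma map_count_le_total: "map_count P n \<le> total_count n"
proof (induction n arbitrary: P rule: less_induct)
  case (less n)
  show ?case
  proof (cases n)
    case (Suc k)
    then show ?thesis
      using less by (auto simp: o_def intro!: add_mono mult_le_mono sum_mono)
  qed simp
qed

text \<open>The series \<open>A\<close> of the double factorials linearises the Riccati equation for the series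
  \<open>M\<close> of all rooted maps: \<open>A (1 - z M) = 1\<close>.\<close>

lemma total_count_convolution:
  "(\<Sum>i\<le>n. total_count i * odd_fact (n - i)) = odd_fact (Suc n)"
proof -
  define A :: "real fps" where "A = Abs_fps (\<lambda>n. of_nat (odd_fact n))"
  define M :: "real fps" where "M = Abs_fps (\<lambda>n. of_nat (total_count n))"
  let ?z = "fps_X :: real fps"
  have A_eq: "2 * ?z\<^sup>2 * fps_deriv A = A - 1 - ?z * A"
  proof (rule fps_ext)
    fix n
    show "fps_nth (2 * ?z\<^sup>2 * fps_deriv A) n = fps_nth (A - 1 - ?z * A) n"
      by (cases n) (auto simp: A_def power2_eq_square mult.assoc numeral_fps_const algebra_simps
          split: nat.splits simp del: of_nat_Suc) 
  qed
  define Q where "Q = M * M"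
  have Q_nth: "fps_nth Q n = (\<Sum>i\<le>n. real (total_count i) * real (total_count (n - i)))" for n
    by (simp add: Q_def M_def fps_mult_nth atMost_atLeast0)
  have M_eq: "2 * ?z\<^sup>2 * fps_deriv M = M - 1 - ?z * M - ?z * Q"
  proof (rule fps_ext)
    fix n
    show "fps_nth (2 * ?z\<^sup>2 * fps_deriv M) n = fps_nth (M - 1 - ?z * M - ?z * Q) n"
      by (cases n) (auto simp: M_def power2_eq_square mult.assoc numeral_fps_const algebra_simps
          Q_nth o_def
          split: nat.splits simp del: of_nat_Suc)
  qed
  \<comment> \<open>\<open>P\<close> is the expected inverse of \<open>A\<close>, and
    \<open>D\<close> is the defect. The quadratic term of the equation for \<open>M\<close> turns
    into \<open>P * P\<close>; in the derivative of \<open>A * P\<close> all else cancels, which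
    leaves a linear homogeneous equation for \<open>D\<close>.\<close>
  define P where "P = 1 - ?z * M"
  define D where "D = A * P - 1"
  have "2 * ?z\<^sup>2 * fps_deriv P = - 2 * ?z\<^sup>2 * M - ?z * (2 * ?z\<^sup>2 * fps_deriv M)"
    by (simp add: P_def algebra_simps power2_eq_square)
  also have "\<dots> = P * P - P + ?z * P"
    unfolding M_eq P_def Q_def by (simp add: algebra_simps power2_eq_square)
  finally have P_eq: "2 * ?z\<^sup>2 * fps_deriv P = P * P - P + ?z * P" .
  have "2 * ?z\<^sup>2 * fps_deriv D = (2 * ?z\<^sup>2 * fps_deriv A) * P + A * (2 * ?z\<^sup>2 * fps_deriv P)"
    by (simp add: D_def algebra_simps)
  also have "\<dots> = P * D"
    unfolding A_eq P_eq D_def by (simp add: algebra_simps)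
  finally have D_eq: "2 * ?z\<^sup>2 * fps_deriv D = P * D" .
  \<comment> \<open>The operator on the left raises degrees by one, so its coefficient
    \<open>n\<close> involves \<open>D\<close> only at \<open>n - 1\<close>; on the right
    \<open>P\<close> has constant term 1 and isolates \<open>D\<close> at \<open>n\<close>.\<close>
  have D0: "fps_nth D n = 0" for n
  proof (induction n rule: less_induct)
    case (less n)
    have "fps_nth (2 * ?z\<^sup>2 * fps_deriv D) n = 0"
      using less by (cases n) (auto simp: power2_eq_square mult.assoc numeral_fps_const split: nat.splits)
    moreover have "fps_nth (P * D) n = fps_nth P 0 * fps_nth D n"
      unfolding fps_mult_nth using less
      by (subst sum.remove[of _ 0]) (auto intro!: sum.neutral)
    ultimately show ?case
      unfolding D_eq by (simp add: P_def)
  qed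
  then have "D = 0" by (simp add: fps_eq_iff)
  then have "A - 1 = ?z * (M * A)"
    by (simp add: D_def P_def algebra_simps)
  then have "fps_nth (A - 1) (Suc n) = fps_nth (M * A) n" by simp
  then have "real (odd_fact (Suc n)) = (\<Sum>i\<le>n. real (total_count i) * real (odd_fact (n - i)))"
    by (simp add: A_def M_def fps_mult_nth atMost_atLeast0)
  then show ?thesis
    by (metis (mono_tags, lifting) of_nat_eq_iff of_nat_mult of_nat_sum sum.cong)
qed

section \<open>Two-sided bounds by double factorials\<close>

lemma total_count_le: "total_count n \<le> odd_fact (Suc n)"
proof -
  have "total_count n * odd_fact (n - n) \<le> (\<Sum>i\<le>n. total_count i * odd_fact (n - i))"
    by (rule member_le_sum) auto
  then show ?thesis unfolding total_count_convolution by simp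
qed

lemma odd_fact_pos: "odd_fact n > 0"
  by (induction n) auto

lemma sum_ends:
  fixes f :: "nat \<Rightarrow> 'a::comm_monoid_add"
  assumes "n \<ge> 1"
  shows "(\<Sum>i\<le>n. f i) = f 0 + f n + (\<Sum>i=1..<n. f i)"
proof -
  have "{..n} = insert 0 (insert n {1..<n})" using assms by auto
  then show ?thesis using assms by (simp add: add.assoc)
qed

text \<open>\<open>i = 0\<close> means that the first map of construction (i) is trivial,
  \<open>i = n\<close> that the second one is. These two ends can have the order of
  \<open>total_count n\<close> and determine the limit; the remaining sum is negligible.\<close>

lemma map_count_Suc:
  assumes "n \<ge> 1"
  shows "map_count P (Suc n) = (2 * n + 1) * map_count P n + of_bool (P 1) * total_count n
    + map_count (P \<circ> Suc) n + (\<Sum>i=1..<n. map_count (P \<circ> Suc) i * total_count (n - i))"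
  using assms by (simp add: sum_ends)

text \<open>Without the middle sum, \<open>total_count\<close> still gains the factor 2n+3 for
  \<open>n \<ge> 1\<close>, exactly as the double factorial does. The ratio drops only once, from n
  = 0 to n = 1, where the two ends of the convolution coincide and the factor is 2 instead of 3;
  this is the origin of 2/3, attained at n = 1.\<close>

lemma total_count_ge: "2 * odd_fact (Suc n) \<le> 3 * total_count n"
proof (induction n)
  case (Suc n)
  show ?case
  proof (cases "n = 0")
    case False
    then have "total_count (Suc n) \<ge> (2 * n + 3) * total_count n"
      using map_count_le_total[of "\<lambda>_. True" n]
      by (subst map_count_Suc) (auto simp: o_def add_mult_distrib simp del: map_count.simps(2))
    moreover have "(2 * n + 3) * (2 * odd_fact (Suc n)) \<le> (2 * n + 3) * (3 * total_count n)"
      using Suc by (rule mult_le_mono2)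
    moreover have "2 * odd_fact (Suc (Suc n)) = (2 * n + 3) * (2 * odd_fact (Suc n))"
      by (simp add: algebra_simps)
    ultimately show ?thesis by linarith
  next
    case True
    then show ?thesis by simp
  qed
qed simp

lemma total_count_pos: "total_count n > 0"
  using total_count_ge[of n] odd_fact_pos[of "Suc n"] by auto

text \<open>Log-convexity: for a fixed sum of the indices, both at least \<open>s\<close>, the
  product is largest when one index is \<open>s\<close>. Each factor gained on the left is dominated
  by the one gained on the right.\<close>

lemma odd_fact_mult_le:
  "odd_fact (s + i) * odd_fact (s + j) \<le> odd_fact s * odd_fact (s + i + j)"
proof (induction i)
  case (Suc i)
  have "odd_fact (s + Suc i) * odd_fact (s + j)
      = (2 * (s + i) + 1) * (odd_fact (s + i) * odd_fact (s + j))" by (simp add: algebra_simps)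
  also have "\<dots> \<le> (2 * (s + i + j) + 1) * (odd_fact s * odd_fact (s + i + j))"
    using Suc by (intro mult_le_mono[OF _ Suc]) auto
  finally show ?case by (simp add: algebra_simps)
qed simp

text \<open>Log-convexity with \<open>s = 2\<close> bounds a term by 3 \<open>odd_fact n\<close>;
  over all terms this would add up to the order of \<open>total_count n\<close>. So
  \<open>s = 2\<close> serves only the terms next to the two ends, and the others use
  \<open>s = 3\<close>, where the smaller \<open>odd_fact (n - 1)\<close> absorbs the number of
  terms: 3 + 3 + 15 = 21.\<close>

lemma total_count_middle:
  assumes "n \<ge> 3"
  shows "(\<Sum>i=1..<n. total_count i * total_count (n - i)) \<le> 21 * odd_fact n"
proof -
  have *: "total_count i * total_count (n - i) \<le> odd_fact s * odd_fact (Suc (Suc n) - s)"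
    if "i + 1 \<ge> s" "n + 1 \<ge> i + s" "i \<le> n" for i s
  proof -
    have s: "s + (i + 1 - s) = Suc i" "s + (n + 1 - i - s) = Suc (n - i)"
      using that by (auto simp: Suc_diff_le)
    have "total_count i * total_count (n - i) \<le> odd_fact (s + (i + 1 - s)) * odd_fact (s + (n + 1 - i - s))"
      unfolding s by (intro mult_le_mono total_count_le)
    also have "\<dots> \<le> odd_fact s * odd_fact (s + (i + 1 - s) + (n + 1 - i - s))"
      by (rule odd_fact_mult_le)
    also have "s + (i + 1 - s) + (n + 1 - i - s) = Suc (Suc n) - s"
      using that by linarith
    finally show ?thesis .
  qed
  have ends: "total_count i * total_count (n - i) \<le> 3 * odd_fact n" if "i = 1 \<or> i = n - 1" for i
    using *[of 2 i] assms that by (auto simp: numeral_2_eq_2 numeral_3_eq_3)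
  have mids: "(\<Sum>i=2..<n - 1. total_count i * total_count (n - i)) \<le> 15 * odd_fact n"
  proof -
    have o3: "odd_fact 3 = 15" by (simp add: numeral_3_eq_3)
    have "(\<Sum>i=2..<n - 1. total_count i * total_count (n - i)) \<le> (\<Sum>i=2..<n - 1. 15 * odd_fact (n - 1))"
      using *[of 3] assms by (intro sum_mono) (auto simp: o3)
    also have "\<dots> = 15 * ((n - 3) * odd_fact (n - 1))" by (simp add: numeral_3_eq_3)
    also have "(n - 3) * odd_fact (n - 1) \<le> (2 * (n - 1) + 1) * odd_fact (n - 1)"
      by (intro mult_le_mono) auto
    also have "\<dots> = odd_fact (Suc (n - 1))" by simp
    also have "Suc (n - 1) = n" using assms by simp
    finally show ?thesis by simp
  qed
  have "{1..<n} = insert 1 (insert (n - 1) {2..<n - 1})" using assms by auto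
  then have "(\<Sum>i=1..<n. total_count i * total_count (n - i))
      = total_count 1 * total_count (n - 1) + (total_count (n - 1) * total_count (n - (n - 1))
        + (\<Sum>i=2..<n - 1. total_count i * total_count (n - i)))"
    using assms by (simp del: map_count.simps)
  then show ?thesis using ends[of 1] ends[of "n - 1"] mids by linarith
qed

lemma middle_tendsto_0:
  "(\<lambda>n. real (\<Sum>i=1..<n. map_count (P \<circ> Suc) i * total_count (n - i)) / real (total_count n)) \<longlonglongrightarrow> 0"
proof (rule tendsto_sandwich[OF _ _ tendsto_const])
  \<comment> \<open>21 from \<open>total_count_middle\<close> times 3/2 from
    \<open>total_count_ge\<close> is 31.5, rounded up.\<close>
  show "(\<lambda>n. 32 / (2 * real n + 1)) \<longlonglongrightarrow> 0"
    by real_asymp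
  show "\<forall>\<^sub>F n in sequentially. real (\<Sum>i=1..<n. map_count (P \<circ> Suc) i * total_count (n - i)) / real (total_count n)
     \<le> 32 / (2 * real n + 1)"
  proof (rule eventually_sequentiallyI)
    fix n :: nat assume n: "n \<ge> 3"
    have "(\<Sum>i=1..<n. map_count (P \<circ> Suc) i * total_count (n - i))
        \<le> (\<Sum>i=1..<n. total_count i * total_count (n - i))"
      by (intro sum_mono mult_le_mono map_count_le_total order_refl)
    also have "\<dots> \<le> 21 * odd_fact n" by (rule total_count_middle[OF n])
    finally have a: "real (\<Sum>i=1..<n. map_count (P \<circ> Suc) i * total_count (n - i)) \<le> 21 * real (odd_fact n)"
      by (metis (no_types, lifting) of_nat_le_iff of_nat_mult of_nat_numeral)
    have "2 * ((2 * n + 1) * odd_fact n) \<le> 3 * total_count n"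
      using total_count_ge[of n] by simp
    then have "real (2 * ((2 * n + 1) * odd_fact n)) \<le> real (3 * total_count n)"
      by (rule of_nat_mono)
    then have "2 * (2 * real n + 1) * real (odd_fact n) \<le> 3 * real (total_count n)"
      by (simp add: algebra_simps)
    then have "(2 * real n + 1) * (21 * real (odd_fact n)) \<le> 32 * real (total_count n)"
      by (simp add: algebra_simps)
    moreover have "(2 * real n + 1) * real (\<Sum>i=1..<n. map_count (P \<circ> Suc) i * total_count (n - i))
      \<le> (2 * real n + 1) * (21 * real (odd_fact n))"
      using a by (intro mult_left_mono) auto
    ultimately have "(2 * real n + 1) * real (\<Sum>i=1..<n. map_count (P \<circ> Suc) i * total_count (n - i))
      \<le> 32 * real (total_count n)" by linarith
    then show "real (\<Sum>i=1..<n. map_count (P \<circ> Suc) i * total_count (n - i)) / real (total_count n)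
       \<le> 32 / (2 * real n + 1)"
      using total_count_pos[of n] by (subst pos_divide_le_eq) (auto simp: pos_le_divide_eq mult.commute)
  qed
qed (auto intro!: always_eventually divide_nonneg_nonneg sum_nonneg)

section \<open>Contraction towards the limit\<close>

lemma cesaro_bound:
  fixes D \<delta> :: "nat \<Rightarrow> real"
  assumes step: "\<And>n. n \<ge> 1 \<Longrightarrow> D (Suc n) \<le> D n + \<delta> n" and pos: "\<And>n. D n \<ge> 0"
    and \<delta>: "\<delta> \<longlonglongrightarrow> 0"
  shows "(\<lambda>n. D n / (2 * real n + 1)) \<longlonglongrightarrow> 0"
proof (rule LIMSEQ_I)
  fix e :: real assume e: "e > 0"
  obtain N0 where N0: "\<And>n. n \<ge> N0 \<Longrightarrow> \<bar>\<delta> n\<bar> < e"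
    using LIMSEQ_D[OF \<delta> e] by auto
  define N where "N = max 1 N0"
  \<comment> \<open>From \<open>N\<close> on the increments are at most \<open>e\<close>; division
    by 2n+1 turns the slope \<open>e\<close> into at most \<open>e / 2\<close>, which leaves
    \<open>e / 2\<close> for the fixed value \<open>D N\<close>.\<close>
  have lin: "D (N + k) \<le> D N + e * real k" for k
  proof (induction k)
    case (Suc k)
    have "D (N + Suc k) \<le> D (N + k) + \<delta> (N + k)" using step[of "N + k"] by (simp add: N_def)
    moreover have "\<delta> (N + k) \<le> e" using N0[of "N + k"] by (force simp: N_def)
    ultimately show ?case using Suc by (simp add: algebra_simps)
  qed simp
  have "(\<lambda>n. D N / (2 * real n + 1)) \<longlonglongrightarrow> 0" by real_asymp
  then obtain N1 where N1: "\<And>n. n \<ge> N1 \<Longrightarrow> \<bar>D N / (2 * real n + 1)\<bar> < e / 2"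
    using LIMSEQ_D[of _ 0 "e / 2"] e by (metis (no_types, lifting) diff_zero half_gt_zero real_norm_def)
  show "\<exists>no. \<forall>n\<ge>no. norm (D n / (2 * real n + 1) - 0) < e"
  proof (intro exI allI impI)
    fix n assume n: "n \<ge> max N N1"
    have "D n \<le> D N + e * real n"
      using lin[of "n - N"] n e by (smt (verit) le_add_diff_inverse max.bounded_iff mult_left_mono of_nat_mono diff_le_self)
    then have "D n / (2 * real n + 1) \<le> D N / (2 * real n + 1) + e * real n / (2 * real n + 1)"
      by (simp add: add_divide_distrib[symmetric] divide_right_mono)
    moreover have "e * real n / (2 * real n + 1) \<le> e / 2"
      using e by (simp add: divide_simps algebra_simps)
    moreover have "D N / (2 * real n + 1) < e / 2" using N1[of n] n abs_ge_self[of "D N / (2 * real n + 1)"]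
      by (meson le_less_trans max.bounded_iff)
    ultimately have "D n / (2 * real n + 1) < e" by linarith
    then show "norm (D n / (2 * real n + 1) - 0) < e"
      using pos[of n] by simp
  qed
qed

text \<open>Dividing the recursion by \<open>total_count n\<close> gives \<open>x_rec\<close>. A
  constant L is compatible with it in the limit exactly if 2L = \<open>of_bool (P 1) + y\<close>.
  The weight 2n+1 makes the errors telescope, because the factor 2n+3+\<epsilon> in front of the
  next ratio is at least the next weight.\<close>

lemma ratio_step:
  assumes y: "(\<lambda>n. real (map_count (P \<circ> Suc) n) / real (total_count n)) \<longlonglongrightarrow> y"
  shows "(\<lambda>n. real (map_count P n) / real (total_count n)) \<longlonglongrightarrow> (of_bool (P 1) + y) / 2"
proof -
  define t where "t n = real (total_count n)" for n
  define x where "x n = real (map_count P n) / t n" for n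
  define x' where "x' n = real (map_count (P \<circ> Suc) n) / t n" for n
  define \<epsilon>' where "\<epsilon>' n = real (\<Sum>i=1..<n. map_count (P \<circ> Suc) i * total_count (n - i)) / t n" for n
  define \<epsilon> where "\<epsilon> n = real (\<Sum>i=1..<n. total_count i * total_count (n - i)) / t n" for n
  define L where "L = (of_bool (P 1) + y) / 2"
  have t: "t n > 0" for n using total_count_pos by (simp add: t_def)
  have \<epsilon>0: "\<epsilon> n \<ge> 0" for n using t[of n] by (simp add: \<epsilon>_def sum_nonneg)
  have \<epsilon>_lim: "\<epsilon> \<longlonglongrightarrow> 0" and \<epsilon>'_lim: "\<epsilon>' \<longlonglongrightarrow> 0" and x'_lim: "x' \<longlonglongrightarrow> y"
    using middle_tendsto_0[of "\<lambda>_. True"] middle_tendsto_0[of P] y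
    unfolding \<epsilon>_def \<epsilon>'_def x'_def t_def by (simp_all add: o_def)
  \<comment> \<open>The residue that the constant \<open>L\<close> leaves in the recursion; it tends
    to 0 by the choice of \<open>L\<close>.\<close>
  define \<delta> where "\<delta> n = \<bar>of_bool (P 1) + x' n + \<epsilon>' n - (2 + \<epsilon> n) * L\<bar>" for n
  have "\<delta> \<longlonglongrightarrow> \<bar>of_bool (P 1) + y + 0 - (2 + 0) * L\<bar>"
    unfolding \<delta>_def by (intro tendsto_intros \<epsilon>_lim \<epsilon>'_lim x'_lim)
  then have \<delta>: "\<delta> \<longlonglongrightarrow> 0" by (simp add: L_def add_divide_distrib)
  have x_rec: "(2 * real n + 3 + \<epsilon> n) * x (Suc n) = (2 * real n + 1) * x n + of_bool (P 1) + x' n + \<epsilon>' n"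
    if "n \<ge> 1" for n
  proof -
    have "real (map_count P (Suc n)) = t n * ((2 * real n + 1) * x n + of_bool (P 1) + x' n + \<epsilon>' n)"
      using t[of n] that unfolding x_def x'_def \<epsilon>'_def
      by (subst map_count_Suc) (simp_all add: t_def divide_simps, simp add: algebra_simps)
    moreover have "t (Suc n) = t n * (2 * real n + 3 + \<epsilon> n)"
      using t[of n] that unfolding \<epsilon>_def
      by (subst t_def, subst map_count_Suc) (simp_all add: distrib_left t_def o_def)
    ultimately show ?thesis
      using t[of n] \<epsilon>0[of n] by (auto simp: x_def[of "Suc n"])
  qed
  have "(\<lambda>n. (2 * real n + 1) * \<bar>x n - L\<bar> / (2 * real n + 1)) \<longlonglongrightarrow> 0"
  proof (rule cesaro_bound[OF _ _ \<delta>])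
    fix n :: nat assume n: "n \<ge> 1"
    have "(2 * real n + 3 + \<epsilon> n) * (x (Suc n) - L)
        = (2 * real n + 1) * (x n - L) + (of_bool (P 1) + x' n + \<epsilon>' n - (2 + \<epsilon> n) * L)"
      using x_rec[OF n] by (simp add: algebra_simps)
    then have "\<bar>2 * real n + 3 + \<epsilon> n\<bar> * \<bar>x (Suc n) - L\<bar> \<le> \<bar>2 * real n + 1\<bar> * \<bar>x n - L\<bar> + \<delta> n"
      unfolding \<delta>_def abs_mult[symmetric] by (metis abs_triangle_ineq)
    moreover have "(2 * real n + 3) * \<bar>x (Suc n) - L\<bar> \<le> \<bar>2 * real n + 3 + \<epsilon> n\<bar> * \<bar>x (Suc n) - L\<bar>"
      using \<epsilon>0[of n] by (intro mult_right_mono) auto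
    ultimately show "(2 * real (Suc n) + 1) * \<bar>x (Suc n) - L\<bar> \<le> (2 * real n + 1) * \<bar>x n - L\<bar> + \<delta> n"
      by (simp add: algebra_simps)
  qed auto
  moreover have "(2 * real n + 1) * \<bar>x n - L\<bar> / (2 * real n + 1) = \<bar>x n - L\<bar>" for n
    by (rule nonzero_mult_div_cancel_left) linarith
  ultimately have "(\<lambda>n. \<bar>x n - L\<bar>) \<longlonglongrightarrow> 0" by simp
  then have "x \<longlonglongrightarrow> L" by (simp add: tendsto_rabs_zero_iff LIM_zero_iff)
  then show ?thesis by (simp add: x_def[abs_def] t_def L_def)
qed

lemma map_count_False: "map_count (\<lambda>_. False) n = 0"
  by (induction n rule: less_induct) (case_tac x; simp add: o_def)

text \<open>Composition with \<open>Suc\<close> turns \<open>c = Suc k\<close> into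
  \<open>c = k\<close>, so from \<open>k = 2\<close> on each limit is half of the previous one. The
  case \<open>c = 1\<close> receives nothing from \<open>c = 0\<close> and gets its 1/2 from
  \<open>of_bool (P 1)\<close>, that is, from the maps whose first component is trivial.\<close>

lemma map_count_ratio:
  "(\<lambda>n. real (map_count (\<lambda>c. c = k) n) / real (total_count n)) \<longlonglongrightarrow> (if k = 0 then 0 else (1 / 2) ^ k)"
proof (induction k)
  case 0
  have "(\<lambda>c. c = (0::nat)) \<circ> Suc = (\<lambda>_. False)" by auto
  then show ?case using ratio_step[of "\<lambda>c. c = 0" 0] by (simp add: map_count_False)
next
  case (Suc k)
  have "(\<lambda>c. c = Suc k) \<circ> Suc = (\<lambda>c. c = k)" by auto
  then show ?case using ratio_step[of "\<lambda>c. c = Suc k" "if k = 0 then 0 else (1 / 2) ^ k"] Suc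
    by (auto split: if_splits)
qed

section \<open>First returns and the decomposition of connected permutations\<close>

text \<open>Guarantees that the \<open>LEAST\<close> in \<open>first_return\<close> is attained.
  With \<open>k > 0\<close>, membership of \<open>x\<close> itself in \<open>S\<close> is not a
  return.\<close>

definition returns :: "('a \<Rightarrow> 'a) \<Rightarrow> 'a set \<Rightarrow> 'a \<Rightarrow> bool" where
  "returns f S x \<longleftrightarrow> (\<exists>k>0. (f ^^ k) x \<in> S)"

lemma returns_step: "f x \<in> S \<Longrightarrow> returns f S x"
  unfolding returns_def by (intro exI[of _ 1]) auto

lemma returns_Suc: "returns f S (f x) \<Longrightarrow> returns f S x"
  unfolding returns_def by (metis comp_apply funpow_Suc_right zero_less_Suc)

lemma returns_mono: "returns f S x \<Longrightarrow> S \<subseteq> A \<Longrightarrow> returns f A x"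
  unfolding returns_def by blast

text \<open>Induction on the number of steps to the next visit of \<open>S\<close>; with
  \<open>first_return_now\<close> and \<open>first_return_later\<close> it replaces reasoning about
  the \<open>LEAST\<close>.\<close>

lemma returns_induct [consumes 1, case_names now later]:
  assumes "returns f S x"
    and now: "\<And>x. f x \<in> S \<Longrightarrow> Q x"
    and later: "\<And>x. f x \<notin> S \<Longrightarrow> returns f S (f x) \<Longrightarrow> Q (f x) \<Longrightarrow> Q x"
  shows "Q x"
proof -
  obtain k where "0 < k" "(f ^^ k) x \<in> S" using assms(1) unfolding returns_def by auto
  then show ?thesis
  proof (induction k arbitrary: x)
    case (Suc k)
    then have k: "(f ^^ k) (f x) \<in> S" by (simp add: funpow_swap1)
    show ?case
    proof (cases "f x \<in> S")
      case False
      then have "k > 0" using k by (cases k) auto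
      then have "Q (f x)" "returns f S (f x)" using Suc.IH k by (auto simp: returns_def)
      then show ?thesis using later False by blast
    qed (rule now)
  qed simp
qed

lemma first_return_now: "f x \<in> S \<Longrightarrow> first_return f S x = f x"
  unfolding first_return_def by (subst Least_equality[of _ 1]) auto

lemma first_return_later:
  assumes "f x \<notin> S" "returns f S x"
  shows "first_return f S x = first_return f S (f x)"
proof -
  obtain k where k: "0 < k" "(f ^^ k) x \<in> S" using assms(2) unfolding returns_def by auto
  have "(LEAST k. 0 < k \<and> (f ^^ k) x \<in> S) = Suc (LEAST k. 0 < Suc k \<and> (f ^^ Suc k) x \<in> S)"
    using k by (intro Least_Suc) auto
  also have "(\<lambda>k. 0 < Suc k \<and> (f ^^ Suc k) x \<in> S) = (\<lambda>k. 0 < k \<and> (f ^^ k) (f x) \<in> S)"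
  proof
    \<comment> \<open>For \<open>k = 0\<close> both sides fail, the left one because
      \<open>f x\<close> is outside \<open>S\<close>.\<close>
    fix k show "(0 < Suc k \<and> (f ^^ Suc k) x \<in> S) = (0 < k \<and> (f ^^ k) (f x) \<in> S)"
      using assms(1) by (cases k) (auto simp: funpow_swap1)
  qed
  finally show ?thesis unfolding first_return_def by (simp add: funpow_swap1)
qed

lemma first_return_in: "returns f S x \<Longrightarrow> first_return f S x \<in> S"
  by (induction rule: returns_induct) (auto simp: first_return_now first_return_later returns_Suc)

lemma first_return_cong:
  assumes "x \<in> Z" "\<And>y. y \<in> Z \<Longrightarrow> f y \<in> Z \<and> f' y = f y" "S \<inter> Z = S' \<inter> Z"
  shows "first_return f S x = first_return f' S' x"
proof -
  have *: "(f ^^ k) x \<in> Z \<and> (f' ^^ k) x = (f ^^ k) x" for k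
    using assms(1,2) by (induction k) auto
  then have "(\<lambda>k. 0 < k \<and> (f ^^ k) x \<in> S) = (\<lambda>k. 0 < k \<and> (f' ^^ k) x \<in> S')"
    using assms(3) by (intro ext) auto
  then show ?thesis using * by (simp add: first_return_def)
qed

lemma returns_first_return:
  assumes "S \<subseteq> A" "returns f S x"
  shows "returns (first_return f A) S x"
  using assms(2)
proof (induction rule: returns_induct)
  case (now x)
  then show ?case using assms(1) by (intro returns_step) (auto simp: first_return_now)
next
  case (later x)
  show ?case
  proof (cases "f x \<in> A")
    case True
    then show ?thesis using later.IH by (intro returns_Suc[of _ _ x]) (simp add: first_return_now)
  next
    case False
    then have "first_return f A x = first_return f A (f x)"
      using later.hyps assms(1) by (intro first_return_later) (auto intro: returns_Suc returns_mono)
    then have "(first_return f A ^^ Suc k) x = (first_return f A ^^ Suc k) (f x)" for k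
      by (simp add: funpow_swap1)
    then show ?thesis using later.IH unfolding returns_def by (metis gr0_implies_Suc zero_less_Suc)
  qed
qed

text \<open>Skipping in two stages equals skipping at once. The rotation of a represented map is
  itself a first return, so this is what describes a further deletion, and also the dropping of a
  phantom.\<close>

lemma first_return_first_return:
  assumes "S \<subseteq> A" "returns f S x"
  shows "first_return (first_return f A) S x = first_return f S x"
  using assms(2)
proof (induction rule: returns_induct)
  case (now x)
  then have "first_return f A x = f x" using assms(1) by (auto intro: first_return_now)
  then show ?case using now by (simp add: first_return_now)
next
  case (later x)
  have ret: "returns f S x" using later.hyps by (auto intro: returns_Suc)
  show ?case
  proof (cases "f x \<in> A")
    case True
    then have "first_return f A x = f x" by (rule first_return_now)
    then show ?thesis using later ret assms(1)
      by (metis first_return_later returns_first_return)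
  next
    case False
    \<comment> \<open>The points \<open>x\<close> and \<open>f x\<close> have the same first return
      to \<open>A\<close>, so all positive iterates of \<open>first_return f A\<close> agree at
      both, and so do the next visits of \<open>S\<close>.\<close>
    have g: "first_return f A x = first_return f A (f x)"
      using later.hyps False assms(1) by (intro first_return_later) (auto intro: returns_Suc returns_mono)
    then have "(first_return f A ^^ Suc k) x = (first_return f A ^^ Suc k) (f x)" for k
      by (simp add: funpow_swap1)
    then have *: "0 < k \<Longrightarrow> (first_return f A ^^ k) x = (first_return f A ^^ k) (f x)" for k
      by (cases k) auto
    then have "(\<lambda>k. 0 < k \<and> (first_return f A ^^ k) x \<in> S) = (\<lambda>k. 0 < k \<and> (first_return f A ^^ k) (f x) \<in> S)"
      by auto
    moreover obtain k where "0 < k" "(first_return f A ^^ k) x \<in> S"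
      using returns_first_return[OF assms(1) ret] unfolding returns_def by auto
    then have "0 < (LEAST k. 0 < k \<and> (first_return f A ^^ k) x \<in> S)"
      by (metis (mono_tags, lifting) LeastI)
    ultimately have "first_return (first_return f A) S x = first_return (first_return f A) S (f x)"
      unfolding first_return_def[of "first_return f A"] using * by simp
    then show ?thesis using later ret by (simp add: first_return_later)
  qed
qed

lemma first_return_funpow_pos:
  assumes "k > 0" "(f ^^ k) x \<in> S"
  shows "\<exists>j>0. (first_return f S ^^ j) x = (f ^^ k) x"
  using assms
proof (induction k arbitrary: x)
  case (Suc k)
  have k: "(f ^^ k) (f x) \<in> S" using Suc.prems by (simp add: funpow_swap1)
  show ?case
  proof (cases "k = 0")
    case True
    then show ?thesis using Suc.prems by (intro exI[of _ 1]) (simp add: first_return_now)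
  next
    case False
    then obtain j where j: "j > 0" "(first_return f S ^^ j) (f x) = (f ^^ k) (f x)"
      using Suc.IH[of "f x"] k by auto
    show ?thesis
    proof (cases "f x \<in> S")
      case True
      then have "(first_return f S ^^ Suc j) x = (f ^^ Suc k) x"
        using j by (simp add: first_return_now funpow_swap1)
      then show ?thesis by (intro exI[of _ "Suc j"]) simp
    next
      case False
      have "first_return f S x = first_return f S (f x)"
        using False \<open>k \<noteq> 0\<close> k returns_Suc[of f S x] by (intro first_return_later) (auto simp: returns_def)
      moreover obtain i where "j = Suc i" using j(1) gr0_implies_Suc by auto
      ultimately have "(first_return f S ^^ j) x = (f ^^ Suc k) x"
        using j by (simp add: funpow_swap1)
      then show ?thesis using j(1) by (intro exI[of _ j]) simp
    qed
  qed
qed simp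

text \<open>The orbits of the first return are the traces on \<open>S\<close> of the orbits of
  \<open>f\<close>, so vertices keep their identity when half-edges are skipped.\<close>

lemma first_return_funpow_iff:
  assumes "x \<in> S" "y \<in> S"
  shows "(\<exists>k. (first_return f S ^^ k) x = y) \<longleftrightarrow> (\<exists>k. (f ^^ k) x = y)"
proof
  assume "\<exists>k. (first_return f S ^^ k) x = y"
  then obtain k where "(first_return f S ^^ k) x = y" by auto
  then show "\<exists>k. (f ^^ k) x = y"
  proof (induction k arbitrary: y)
    case 0
    then show ?case by (intro exI[of _ 0]) simp
  next
    case (Suc k)
    then obtain j where "(f ^^ j) x = (first_return f S ^^ k) x" by metis
    then have "first_return f S ((f ^^ j) x) = y" using Suc by simp
    then show ?case unfolding first_return_def by (metis funpow_add comp_apply)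
  qed
next
  assume "\<exists>k. (f ^^ k) x = y"
  then obtain k where k: "(f ^^ k) x = y" by auto
  show "\<exists>k. (first_return f S ^^ k) x = y"
  proof (cases "k = 0")
    case True
    then show ?thesis using k by (intro exI[of _ 0]) simp
  next
    case False
    then show ?thesis using first_return_funpow_pos[of k f x S] k assms by auto
  qed
qed

text \<open>Composition with \<open>transpose a b\<close> on the left puts the fixed point
  \<open>a\<close> into the cycle of \<open>b\<close>, directly before \<open>b\<close>; skipping
  \<open>a\<close> undoes this.\<close>

lemma first_return_insert:
  assumes "p permutes X" "a \<notin> X" "b \<in> X" "x \<in> X"
  shows "first_return (transpose a b \<circ> p) X x = p x"
proof (cases "p x = b")
  case False
  have "p x \<in> X" using assms by (simp add: permutes_in_image)
  then have "(transpose a b \<circ> p) x = p x" using False assms(2) by (auto simp: Transposition.transpose_def)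
  then show ?thesis using \<open>p x \<in> X\<close> by (metis first_return_now)
next
  case True
  let ?s = "transpose a b \<circ> p"
  have x: "?s x = a" and a: "?s a = b"
    using True assms by (auto simp: permutes_not_in)
  then have "first_return ?s X x = first_return ?s X a"
    using assms by (metis first_return_later returns_Suc returns_step)
  also have "\<dots> = b" using a assms(3) by (metis first_return_now)
  finally show ?thesis using True by simp
qed

section \<open>Finite permutations and reachability from the root\<close>

lemma permutes_return:
  assumes "p permutes X" "finite X"
  obtains k where "(p ^^ Suc k) x = x"
proof -
  have "permutation p" using assms permutation_permutes by blast
  then have "x \<in> orbit p x" by (rule permutation_self_in_orbit)
  then obtain n where n: "x = (p ^^ n) x" "0 < n" unfolding orbit_altdef by auto
  then obtain k where "n = Suc k" using gr0_implies_Suc by auto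
  then show ?thesis using that[of k] n(1) by metis
qed

lemma permutes_returns: "p permutes X \<Longrightarrow> finite X \<Longrightarrow> x \<in> S \<Longrightarrow> returns p S x"
  unfolding returns_def using permutes_return[of p X x] by (metis zero_less_Suc)

lemma permutes_funpow_sym:
  assumes "p permutes X" "finite X" "(p ^^ k) x = y"
  shows "\<exists>j. (p ^^ j) y = x"
proof -
  have "permutation p" using assms permutation_permutes by blast
  obtain i where i: "(p ^^ Suc i) x = x" by (rule permutes_return[OF assms(1,2)])
  have "((p ^^ Suc i) ^^ k) x = x" using i by (induction k) auto
  then have "(p ^^ (Suc i * k)) x = x" by (simp only: funpow_mult)
  moreover have "Suc i * k = i * k + k" by simp
  ultimately have "(p ^^ (i * k)) ((p ^^ k) x) = x" by (metis comp_apply funpow_add)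
  then show ?thesis using assms by blast
qed

text \<open>Forward steps are enough, since a permutation of a finite set comes back
  (\<open>reach_back\<close>). Mates are followed inside \<open>A\<close> only: phantoms take part
  in the rotation but not in the matching.\<close>

inductive_set reach :: "'a set \<Rightarrow> ('a \<Rightarrow> 'a) \<Rightarrow> ('a \<Rightarrow> 'a) \<Rightarrow> 'a \<Rightarrow> 'a set"
  for A m \<sigma> r where
  base: "r \<in> reach A m \<sigma> r"
| rot: "x \<in> reach A m \<sigma> r \<Longrightarrow> \<sigma> x \<in> reach A m \<sigma> r"
| mate: "x \<in> reach A m \<sigma> r \<Longrightarrow> x \<in> A \<Longrightarrow> m x \<in> reach A m \<sigma> r"

lemma reach_least:
  assumes "r \<in> X" "\<And>x. x \<in> X \<Longrightarrow> \<sigma> x \<in> X" "\<And>x. x \<in> X \<Longrightarrow> x \<in> A \<Longrightarrow> m x \<in> X"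
  shows "reach A m \<sigma> r \<subseteq> X"
proof
  fix x assume "x \<in> reach A m \<sigma> r" then show "x \<in> X" by induction (use assms in auto)
qed

lemma reach_funpow: "x \<in> reach A m \<sigma> r \<Longrightarrow> (\<sigma> ^^ k) x \<in> reach A m \<sigma> r"
  by (induction k) (auto intro: reach.rot)

lemma reach_back:
  assumes "\<sigma> permutes X" "finite X" "\<sigma> x \<in> reach A m \<sigma> r"
  shows "x \<in> reach A m \<sigma> r"
  using permutes_return[OF assms(1,2), of x] reach_funpow[OF assms(3)] 
  by (metis comp_apply funpow_Suc_right)

lemma reach_cong:
  assumes "r \<in> Z" "\<And>y. y \<in> Z \<Longrightarrow> \<sigma> y \<in> Z \<and> \<sigma>' y = \<sigma> y" "A \<inter> Z = A' \<inter> Z"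
    and "\<And>y. y \<in> Z \<Longrightarrow> y \<in> A \<Longrightarrow> m y \<in> Z \<and> m' y = m y"
  shows "reach A m \<sigma> r = reach A' m' \<sigma>' r"
proof -
  have "x \<in> reach A' m' \<sigma>' r \<inter> Z" if "x \<in> reach A m \<sigma> r" for x
    using that
  proof induction
    case (rot x)
    then show ?case using assms(2)[of x] reach.rot[of x A' m' \<sigma>' r] by auto
  next
    case (mate x)
    then show ?case using assms(3) assms(4)[of x] reach.mate[of x A' m' \<sigma>' r] by auto
  qed (simp add: reach.base assms(1))
  moreover have "x \<in> reach A m \<sigma> r \<inter> Z" if "x \<in> reach A' m' \<sigma>' r" for x
    using that
  proof induction
    case (rot x)
    then show ?case using assms(2)[of x] reach.rot[of x A m \<sigma> r] by auto
  next
    case (mate x)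
    then have "x \<in> A" using assms(3) by auto
    then show ?case using mate assms(4)[of x] reach.mate[of x A m \<sigma> r] by auto
  qed (simp add: reach.base assms(1))
  ultimately show ?thesis by auto
qed

lemma reach_subset:
  assumes "\<sigma> permutes insert r A" "\<And>x. x \<in> A \<Longrightarrow> m x \<in> A"
  shows "reach A m \<sigma> r \<subseteq> insert r A"
  by (rule reach_least) (use assms permutes_in_image[OF assms(1)] in auto)

section \<open>Connected rotations for a fixed matching, and the two constructions\<close>

definition matching :: "('a \<Rightarrow> 'a) \<Rightarrow> 'a set \<Rightarrow> bool" where
  "matching m A \<longleftrightarrow> finite A \<and> (\<forall>x\<in>A. m x \<in> A \<and> m x \<noteq> x \<and> m (m x) = x)"

definition conn_perms :: "'a set \<Rightarrow> ('a \<Rightarrow> 'a) \<Rightarrow> 'a \<Rightarrow> ('a \<Rightarrow> 'a) set" where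
  "conn_perms A m r = {\<sigma>. \<sigma> permutes insert r A \<and> insert r A \<subseteq> reach A m \<sigma> r}"

text \<open>Constructions (ii) and (i): in both, \<open>transpose r h\<close> inserts the new half-edge \<open>h\<close> directly after \<open>r\<close>.\<close>

definition attach :: "'a \<Rightarrow> 'a \<Rightarrow> 'a \<Rightarrow> 'a \<Rightarrow> ('a \<Rightarrow> 'a) \<Rightarrow> 'a \<Rightarrow> 'a" where
  "attach r h h' b \<sigma> = transpose h' b \<circ> \<sigma> \<circ> transpose r h"

definition bridge :: "'a \<Rightarrow> 'a \<Rightarrow> ('a \<Rightarrow> 'a) \<Rightarrow> ('a \<Rightarrow> 'a) \<Rightarrow> 'a \<Rightarrow> 'a" where
  "bridge r h \<alpha> \<beta> = \<alpha> \<circ> \<beta> \<circ> transpose r h"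

lemma matching_subset: "matching m A \<Longrightarrow> B \<subseteq> A \<Longrightarrow> m ` B \<subseteq> B \<Longrightarrow> matching m B"
  unfolding matching_def by (auto intro: finite_subset)

lemma perm_restrict_permutes:
  assumes "p permutes X" "finite X" "D \<subseteq> X" "\<And>x. x \<in> D \<Longrightarrow> p x \<in> D"
  shows "perm_restrict p D permutes D"
proof (rule bij_imp_permutes)
  have "inj_on p D" using assms(1) by (meson permutes_inj inj_on_subset subset_UNIV)
  moreover have "p ` D = D"
    using assms calculation by (intro endo_inj_surj) (auto intro: finite_subset)
  ultimately have "bij_betw p D D" by (simp add: bij_betw_def)
  then show "bij_betw (perm_restrict p D) D D"
    by (rule bij_betw_cong[THEN iffD1, rotated]) (simp add: perm_restrict_def)
qed (simp add: perm_restrict_def)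

text \<open>\<open>h\<close> is to be the half-edge after the root. Cutting takes \<open>h\<close>
  away but keeps \<open>h'\<close> as a phantom in \<open>Y\<close>: it marks the place where the
  edge ended and becomes the root of the second map if the edge is an isthmus. Since
  \<open>h'\<close> is not in \<open>S\<close>, \<open>reach S\<close> does not follow
  \<open>m\<close> there, and the edge is really cut.\<close>

locale root_edge =
  fixes A :: "'a set" and m :: "'a \<Rightarrow> 'a" and r h :: 'a
  assumes matching: "matching m A" and r_notin: "r \<notin> A" and h_in: "h \<in> A"
begin

abbreviation h' where "h' \<equiv> m h"
abbreviation S where "S \<equiv> A - {h, h'}"
abbreviation Y where "Y \<equiv> insert r (insert h' S)"

lemma basics:
  "finite A" "h' \<in> A" "h' \<noteq> h" "m h' = h" "r \<noteq> h" "r \<noteq> h'" "finite Y" "Y = insert r A - {h}"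
  using matching h_in r_notin by (auto simp: matching_def)

lemma m_S: "x \<in> S \<Longrightarrow> m x \<in> S"
  using matching h_in unfolding matching_def by (metis DiffE DiffI insertCI insertE singletonD)

lemma matching_S: "matching m S"
  using matching m_S by (intro matching_subset[OF matching]) auto

text \<open>The composition sends \<open>r\<close> to \<open>\<sigma> h\<close> and fixes
  \<open>h\<close>, so \<open>h\<close> leaves its cycle. The same transposition puts it back, as in
  \<open>glue_permutes\<close>.\<close>

lemma cut_permutes:
  assumes "\<sigma> permutes insert r A" "\<sigma> r = h"
  shows "\<sigma> \<circ> transpose r h permutes Y"
proof -
  let ?t = "\<sigma> \<circ> transpose r h"
  have "?t permutes insert r A"
    using assms h_in by (intro permutes_compose[OF permutes_swap_id]) auto
  moreover have "?t h = h" using assms by simp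
  ultimately show ?thesis unfolding basics(8) permutes_def by (metis DiffI singletonD)
qed

lemma glue_permutes:
  assumes "\<tau> permutes Y"
  shows "\<tau> \<circ> transpose r h permutes insert r A" "(\<tau> \<circ> transpose r h) r = h"
proof -
  have "\<tau> permutes insert r A" using assms by (rule permutes_subset) (use basics in auto)
  then show "\<tau> \<circ> transpose r h permutes insert r A"
    using h_in by (intro permutes_compose[OF permutes_swap_id]) auto
  show "(\<tau> \<circ> transpose r h) r = h" using assms basics by (auto simp: permutes_def)
qed

text \<open>From \<open>r\<close> the rotation leads to \<open>h\<close>, which continues to
  \<open>\<tau> r\<close>, while its mate \<open>h'\<close> opens a second place of departure. Hence
  connectedness of the glued map depends only on the two reachable sets of the cut one.\<close>

lemma reach_glue:
  assumes \<tau>: "\<tau> permutes Y"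
  shows "reach A m (\<tau> \<circ> transpose r h) r = insert h (reach S m \<tau> r \<union> reach S m \<tau> h')"
    (is "?L = ?R")
proof
  let ?\<sigma> = "\<tau> \<circ> transpose r h"
  have \<tau>h: "\<tau> h = h" using \<tau> basics by (auto simp: permutes_def)
  have \<sigma>: "?\<sigma> r = h" "?\<sigma> h = \<tau> r" "\<And>x. x \<noteq> r \<Longrightarrow> x \<noteq> h \<Longrightarrow> ?\<sigma> x = \<tau> x"
    using \<tau>h by (auto simp: Transposition.transpose_def)
  show "?L \<subseteq> ?R"
  proof (rule reach_least)
    fix x assume x: "x \<in> ?R"
    show "?\<sigma> x \<in> ?R"
    proof (cases "x = r \<or> x = h")
      case True
      moreover have "\<tau> r \<in> reach S m \<tau> r" by (intro reach.rot reach.base)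
      ultimately show ?thesis using \<sigma>(1,2) by (auto simp del: comp_apply)
    next
      case False
      then show ?thesis using \<sigma>(3)[of x] x reach.rot[of x S m \<tau>] by (auto simp del: comp_apply)
    qed
  next
    fix x assume x: "x \<in> ?R" "x \<in> A"
    show "m x \<in> ?R"
    proof (cases "x = h \<or> x = h'")
      case True
      then show ?thesis using basics reach.base[of h' S m \<tau>] by auto
    next
      case False
      then show ?thesis using x reach.mate[of x S m \<tau>] by auto
    qed
  qed (auto intro: reach.base)
  have h: "h \<in> ?L" using \<sigma>(1) by (metis reach.base reach.rot)
  then have h': "h' \<in> ?L" using h_in by (rule reach.mate)
  have step: "\<tau> x \<in> ?L" if "x \<in> ?L" for x
    using \<sigma> \<tau>h h that by (metis reach.rot)
  have "reach S m \<tau> r \<subseteq> ?L" "reach S m \<tau> h' \<subseteq> ?L"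
    by (rule reach_least; use h' step in \<open>auto intro: reach.base reach.mate simp del: comp_apply\<close>)+
  then show "?R \<subseteq> ?L" using h by auto
qed

lemma conn_glue_iff:
  assumes \<tau>: "\<tau> permutes Y"
  shows "\<tau> \<circ> transpose r h \<in> conn_perms A m r \<longleftrightarrow> Y \<subseteq> reach S m \<tau> r \<union> reach S m \<tau> h'"
proof -
  have "h \<notin> Y" "insert r A = insert h Y" using basics h_in by auto
  then show ?thesis
    unfolding conn_perms_def mem_Collect_eq reach_glue[OF \<tau>]
    using glue_permutes[OF \<tau>] by auto
qed

lemma reach_attach:
  assumes \<sigma>: "\<sigma> permutes insert r S" and b: "b \<in> insert r S" "b \<in> reach S m \<sigma> r"
  shows "reach S m (transpose h' b \<circ> \<sigma>) r = insert h' (reach S m \<sigma> r)" (is "?L = ?R")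
proof
  let ?t = "transpose h' b \<circ> \<sigma>"
  have \<sigma>h: "\<sigma> h' = h'" using \<sigma> basics by (auto simp: permutes_def)
  have h': "\<sigma> x = h' \<longleftrightarrow> x = h'" for x using \<sigma> \<sigma>h by (metis permutes_inj injD)
  have t: "?t h' = b" "\<And>x. \<sigma> x = b \<Longrightarrow> ?t x = h'" "\<And>x. \<sigma> x \<noteq> b \<Longrightarrow> x \<noteq> h' \<Longrightarrow> ?t x = \<sigma> x"
    using \<sigma>h h' by (auto simp: Transposition.transpose_def)
  show "?L \<subseteq> ?R"
  proof (rule reach_least)
    fix x assume x: "x \<in> ?R"
    then show "?t x \<in> ?R" using t b(2) by (metis insert_iff reach.rot)
  qed (auto intro: reach.intros)
  have sub: "reach S m \<sigma> r \<subseteq> ?L"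
  proof
    fix x assume "x \<in> reach S m \<sigma> r"
    then show "x \<in> ?L"
    proof induction
      case (rot x)
      then show ?case using t \<sigma>h by (metis reach.rot)
    qed (auto intro: reach.intros)
  qed
  \<comment> \<open>The predecessor of \<open>b\<close> is reachable backwards, and the new rotation
    passes from it to \<open>h'\<close>.\<close>
  obtain y where y: "\<sigma> y = b" using \<sigma> by (metis permutes_surj surjD)
  then have "y \<in> reach S m \<sigma> r" using reach_back[OF \<sigma>] basics b by auto
  then have "?t y \<in> ?L" using sub by (intro reach.rot) (auto simp del: comp_apply)
  then have "h' \<in> ?L" using t(2)[OF y] by (simp del: comp_apply)
  then show "?R \<subseteq> ?L" using sub by auto
qed

text \<open>\<open>b\<close> names the corner before it as the place for \<open>h'\<close>, the
  phantom counting as a half-edge; this gives 2n-1 choices if \<open>A\<close> has 2n elements. The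
  root corner is split by \<open>r\<close>: when \<open>S\<close> is nonempty, \<open>b = r\<close>
  and \<open>b = \<sigma> r\<close> are the two ways to attach there.\<close>

lemma attach_conn:
  assumes \<sigma>: "\<sigma> \<in> conn_perms S m r" and b: "b \<in> insert r S"
  shows "attach r h h' b \<sigma> \<in> conn_perms A m r" "transpose h' b \<circ> \<sigma> permutes Y"
    "h' \<in> reach S m (transpose h' b \<circ> \<sigma>) r"
proof -
  have p: "\<sigma> permutes insert r S" and c: "insert r S \<subseteq> reach S m \<sigma> r"
    using \<sigma> by (auto simp: conn_perms_def)
  have "\<sigma> permutes Y" using p by (rule permutes_subset) auto
  then show perm: "transpose h' b \<circ> \<sigma> permutes Y"
    using b by (intro permutes_compose permutes_swap_id) auto
  have *: "reach S m (transpose h' b \<circ> \<sigma>) r = insert h' (reach S m \<sigma> r)"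
    using reach_attach[OF p b] b c by auto
  then show "h' \<in> reach S m (transpose h' b \<circ> \<sigma>) r" by simp
  show "attach r h h' b \<sigma> \<in> conn_perms A m r"
    unfolding attach_def conn_glue_iff[OF perm] * using c by auto
qed

lemma detach_conn:
  assumes \<tau>: "\<tau> permutes Y" and Y: "Y \<subseteq> reach S m \<tau> r"
  shows "\<tau> h' \<in> insert r S" "transpose h' (\<tau> h') \<circ> \<tau> \<in> conn_perms S m r"
proof -
  let ?b = "\<tau> h'"
  let ?\<sigma> = "transpose h' ?b \<circ> \<tau>"
  have inj: "\<tau> x = \<tau> y \<longleftrightarrow> x = y" for x y using \<tau> by (metis permutes_inj injD)
  \<comment> \<open>A fixed point \<open>h'\<close> of \<open>\<tau>\<close> would be entered
    neither by the rotation nor by a mate, as \<open>m\<close> maps \<open>S\<close> to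
    itself.\<close>
  have b: "?b \<noteq> h'"
  proof
    assume eq: "?b = h'"
    have "reach S m \<tau> r \<subseteq> - {h'}"
      by (rule reach_least) (use basics m_S inj[of _ h'] eq in auto)
    then show False using Y by auto
  qed
  have "?b \<in> Y" using permutes_in_image[OF \<tau>, of h'] by auto
  then show b': "?b \<in> insert r S" using b by auto
  have "?\<sigma> permutes Y" using \<tau> \<open>?b \<in> Y\<close> by (intro permutes_compose permutes_swap_id) auto
  moreover have "?\<sigma> h' = h'" by simp
  ultimately have p: "?\<sigma> permutes insert r S"
    unfolding permutes_def by (metis insert_iff)
  \<comment> \<open>A path of \<open>\<tau>\<close> may pass through \<open>h'\<close>, which
    \<open>?\<sigma>\<close> skips; while it stands there, the induction records the reachability of
    the next point \<open>?b\<close> instead.\<close>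
  have "x \<noteq> h' \<and> x \<in> reach S m ?\<sigma> r \<or> x = h' \<and> ?b \<in> reach S m ?\<sigma> r" if "x \<in> reach S m \<tau> r" for x
    using that
  proof induction
    case base
    then show ?case using basics by (auto intro: reach.base)
  next
    case (rot x)
    show ?case
    proof (cases "x = h'")
      case True
      then show ?thesis using rot b by auto
    next
      case False
      then have x: "x \<in> reach S m ?\<sigma> r" using rot by blast
      have "\<tau> x \<noteq> ?b" using inj False by auto
      then have "?\<sigma> x = (if \<tau> x = h' then ?b else \<tau> x)" by (simp add: Transposition.transpose_def)
      then show ?thesis using reach.rot[OF x] by (simp del: comp_apply split: if_splits)
    qed
  next
    case (mate x)
    then show ?case using m_S[of x] by (auto intro: reach.mate)
  qed
  then show "?\<sigma> \<in> conn_perms S m r"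
    unfolding conn_perms_def using p Y basics by blast
qed

text \<open>\<open>\<alpha>\<close> and \<open>\<beta>\<close> have disjoint supports, so their
  product acts as each of them on its own part, and no mate leads across because \<open>B\<close> is
  closed under the involution \<open>m\<close>. Only the glued edge connects the parts.\<close>

lemma bridge_conn:
  assumes B: "B \<subseteq> S" "m ` B \<subseteq> B" and \<alpha>: "\<alpha> \<in> conn_perms B m r" and \<beta>: "\<beta> \<in> conn_perms (S - B) m h'"
  shows "bridge r h \<alpha> \<beta> \<in> conn_perms A m r" "\<alpha> \<circ> \<beta> permutes Y"
    "reach S m (\<alpha> \<circ> \<beta>) r = insert r B"
    "\<And>x. x \<in> insert r B \<Longrightarrow> (\<alpha> \<circ> \<beta>) x = \<alpha> x" "\<And>x. x \<notin> insert r B \<Longrightarrow> (\<alpha> \<circ> \<beta>) x = \<beta> x"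
proof -
  let ?C = "S - B"
  have pa: "\<alpha> permutes insert r B" and ca: "insert r B \<subseteq> reach B m \<alpha> r"
    and pb: "\<beta> permutes insert h' ?C" and cb: "insert h' ?C \<subseteq> reach ?C m \<beta> h'"
    using \<alpha> \<beta> by (auto simp: conn_perms_def)
  have disj: "insert r B \<inter> insert h' ?C = {}" using B basics r_notin by auto
  show on_B: "(\<alpha> \<circ> \<beta>) x = \<alpha> x" if "x \<in> insert r B" for x
  proof -
    have "x \<notin> insert h' ?C" using that disj by blast
    then have "\<beta> x = x" by (rule permutes_not_in[OF pb])
    then show ?thesis by simp
  qed
  show off_B: "(\<alpha> \<circ> \<beta>) x = \<beta> x" if "x \<notin> insert r B" for x
  proof -
    have "\<beta> x \<notin> insert r B"
    proof (cases "x \<in> insert h' ?C")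
      case True
      then have "\<beta> x \<in> insert h' ?C" using permutes_in_image[OF pb] by blast
      then show ?thesis using disj by blast
    next
      case False
      then have "\<beta> x = x" by (rule permutes_not_in[OF pb])
      then show ?thesis using that by simp
    qed
    then have "\<alpha> (\<beta> x) = \<beta> x" by (rule permutes_not_in[OF pa])
    then show ?thesis by simp
  qed
  have "\<alpha> permutes Y" "\<beta> permutes Y"
    using pa pb B by (auto elim!: permutes_subset)
  then show perm: "\<alpha> \<circ> \<beta> permutes Y" by (intro permutes_compose)
  have C: "m x \<in> ?C" if "x \<in> ?C" for x
  proof -
    have "m x \<in> S" using that m_S by auto
    moreover have "m x \<notin> B"
    proof
      assume "m x \<in> B"
      then have "m (m x) \<in> B" using B by auto
      then show False using that matching by (auto simp: matching_def)
    qed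
    ultimately show ?thesis by auto
  qed
  have "reach S m (\<alpha> \<circ> \<beta>) r = reach B m \<alpha> r"
    by (rule reach_cong[of _ "insert r B"])
      (use B on_B r_notin permutes_in_image[OF pa] in \<open>auto simp del: comp_apply\<close>)
  moreover have "reach B m \<alpha> r \<subseteq> insert r B" by (rule reach_subset[OF pa]) (use B in auto)
  ultimately show R: "reach S m (\<alpha> \<circ> \<beta>) r = insert r B" using ca by auto
  have "reach S m (\<alpha> \<circ> \<beta>) h' = reach ?C m \<beta> h'"
  proof (rule reach_cong[of _ "insert h' ?C"])
    fix y assume y: "y \<in> insert h' ?C"
    then have "y \<notin> insert r B" using disj by blast
    then show "(\<alpha> \<circ> \<beta>) y \<in> insert h' ?C \<and> \<beta> y = (\<alpha> \<circ> \<beta>) y"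
      using off_B[of y] pb y by (metis permutes_in_image)
  qed (use C in auto)
  then show "bridge r h \<alpha> \<beta> \<in> conn_perms A m r"
    unfolding bridge_def conn_glue_iff[OF perm] R using cb by auto
qed

lemma split_conn:
  assumes \<tau>: "\<tau> permutes Y" and Y: "Y \<subseteq> reach S m \<tau> r \<union> reach S m \<tau> h'" and h': "h' \<notin> reach S m \<tau> r"
  defines "D \<equiv> reach S m \<tau> r"
  shows "D - {r} \<subseteq> S" "m ` (D - {r}) \<subseteq> D - {r}" "perm_restrict \<tau> D \<in> conn_perms (D - {r}) m r"
    "perm_restrict \<tau> (Y - D) \<in> conn_perms (S - (D - {r})) m h'"
    "perm_restrict \<tau> D \<circ> perm_restrict \<tau> (Y - D) = \<tau>"
proof -
  have rD: "r \<in> D" unfolding D_def by (rule reach.base)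
  have DY: "D \<subseteq> Y" unfolding D_def
    by (rule reach_least) (use permutes_in_image[OF \<tau>] m_S in auto)
  then show DS: "D - {r} \<subseteq> S" using h' by (auto simp: D_def)
  show mD: "m ` (D - {r}) \<subseteq> D - {r}"
    using DS m_S r_notin by (auto simp: D_def intro: reach.mate)
  \<comment> \<open>Closure holds in both directions, as \<open>\<tau>\<close> permutes a finite
    set; therefore the complement is invariant too, and \<open>\<tau>\<close> is the product of its
    two restrictions.\<close>
  have D_step: "\<tau> x \<in> D \<longleftrightarrow> x \<in> D" for x
    unfolding D_def using reach_back[OF \<tau> basics(7)] reach.rot[of x] by auto
  have C: "Y - D = insert h' (S - (D - {r}))" using rD h' basics(5,6) r_notin by (auto simp: D_def)
  have pD: "perm_restrict \<tau> D permutes D" 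
    using \<tau> basics(7) DY D_step by (intro perm_restrict_permutes[of _ Y]) auto
  have pC: "perm_restrict \<tau> (Y - D) permutes Y - D"
    using D_step permutes_in_image[OF \<tau>] by (intro perm_restrict_permutes[OF \<tau> basics(7)]) auto
  have iD: "insert r (D - {r}) = D" using rD by auto
  have "reach (D - {r}) m (perm_restrict \<tau> D) r = D"
    unfolding D_def[symmetric]
    by (subst (2) D_def, rule reach_cong[of _ D])
      (use rD D_step mD DS r_notin in \<open>auto simp: perm_restrict_def\<close>)
  then show "perm_restrict \<tau> D \<in> conn_perms (D - {r}) m r"
    unfolding conn_perms_def using pD iD by auto
  have mC: "m x \<in> Y - D" if "x \<in> Y - D" "x \<in> S" for x
  proof -
    have "m x \<notin> D"
    proof
      assume "m x \<in> D"
      moreover have "m x \<in> S" "m (m x) = x" using that m_S[of x] matching by (auto simp: matching_def)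
      ultimately have "x \<in> D" using mD r_notin by (auto simp: D_def dest: reach.mate)
      then show False using that by auto
    qed
    then show ?thesis using m_S[of x] that by auto
  qed
  have "reach S m \<tau> h' \<subseteq> Y - D"
  proof (rule reach_least)
    fix x assume "x \<in> Y - D"
    then show "\<tau> x \<in> Y - D" using D_step[of x] permutes_in_image[OF \<tau>, of x] by blast
  qed (use h' mC in \<open>auto simp: D_def\<close>)
  then have "Y - D = reach S m \<tau> h'" using Y by (auto simp: D_def)
  moreover have "reach (S - (D - {r})) m (perm_restrict \<tau> (Y - D)) h' = reach S m \<tau> h'"
  proof (rule reach_cong[of _ "Y - D"])
    fix y assume y: "y \<in> Y - D"
    show "perm_restrict \<tau> (Y - D) y \<in> Y - D \<and> \<tau> y = perm_restrict \<tau> (Y - D) y"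
      using y D_step[of y] \<tau> permutes_in_image[OF \<tau>, of y] by (simp add: perm_restrict_def)
    assume "y \<in> S - (D - {r})"
    then show "m y \<in> Y - D \<and> m y = m y" using mC y by blast
  qed (use h' r_notin in \<open>auto simp: D_def\<close>)
  ultimately show "perm_restrict \<tau> (Y - D) \<in> conn_perms (S - (D - {r})) m h'"
    unfolding conn_perms_def using pC C by auto
  have "perm_restrict \<tau> D \<circ> perm_restrict \<tau> (Y - D) = perm_restrict \<tau> (D \<union> (Y - D))"
    using pD pC by (intro perm_restrict_union) auto
  also have "D \<union> (Y - D) = Y" using DY by auto
  also have "perm_restrict \<tau> Y = \<tau>" using \<tau> by (rule perm_restrict_id)
  finally show "perm_restrict \<tau> D \<circ> perm_restrict \<tau> (Y - D) = \<tau>" .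
qed

text \<open>Reachability of \<open>h'\<close> after the cut says that the root edge is no isthmus.
  The attaching corner can be read off from the cut rotation, where \<open>b\<close> is the
  successor of \<open>h'\<close>.\<close>

lemma bij_attach:
  "bij_betw (\<lambda>(b, \<sigma>). attach r h h' b \<sigma>) (insert r S \<times> conn_perms S m r)
     {\<sigma> \<in> conn_perms A m r. \<sigma> r = h \<and> h' \<in> reach S m (\<sigma> \<circ> transpose r h) r}"
proof (rule bij_betwI[where g = "\<lambda>\<sigma>. let \<tau> = \<sigma> \<circ> transpose r h in (\<tau> h', transpose h' (\<tau> h') \<circ> \<tau>)"])
  have tt: "f \<circ> transpose r h \<circ> transpose r h = f" for f :: "'a \<Rightarrow> 'a"
    by (simp add: comp_assoc)
  show "(\<lambda>(b, \<sigma>). attach r h h' b \<sigma>) \<in> insert r S \<times> conn_perms S m r \<rightarrow>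
     {\<sigma> \<in> conn_perms A m r. \<sigma> r = h \<and> h' \<in> reach S m (\<sigma> \<circ> transpose r h) r}"
    using attach_conn glue_permutes(2) by (auto simp: attach_def tt simp del: comp_apply)
  show "(\<lambda>\<sigma>. let \<tau> = \<sigma> \<circ> transpose r h in (\<tau> h', transpose h' (\<tau> h') \<circ> \<tau>))
     \<in> {\<sigma> \<in> conn_perms A m r. \<sigma> r = h \<and> h' \<in> reach S m (\<sigma> \<circ> transpose r h) r} \<rightarrow>
       insert r S \<times> conn_perms S m r"
  proof
    fix \<sigma> assume \<sigma>: "\<sigma> \<in> {\<sigma> \<in> conn_perms A m r. \<sigma> r = h \<and> h' \<in> reach S m (\<sigma> \<circ> transpose r h) r}"
    let ?t = "\<sigma> \<circ> transpose r h"
    have t: "?t permutes Y" using \<sigma> by (intro cut_permutes) (auto simp: conn_perms_def)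
    have "reach S m ?t h' \<subseteq> reach S m ?t r"
      by (rule reach_least) (use \<sigma> in \<open>auto intro: reach.intros simp del: comp_apply\<close>)
    moreover have "?t \<circ> transpose r h \<in> conn_perms A m r" using \<sigma> by (simp add: tt)
    ultimately have "Y \<subseteq> reach S m ?t r" using conn_glue_iff[OF t] by auto
    then show "(let \<tau> = \<sigma> \<circ> transpose r h in (\<tau> h', transpose h' (\<tau> h') \<circ> \<tau>)) \<in> insert r S \<times> conn_perms S m r"
      using detach_conn[OF t] unfolding Let_def by blast
  qed
  show "(let \<tau> = (case p of (b, \<sigma>) \<Rightarrow> attach r h h' b \<sigma>) \<circ> transpose r h in (\<tau> h', transpose h' (\<tau> h') \<circ> \<tau>)) = p"
    if "p \<in> insert r S \<times> conn_perms S m r" for p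
  proof -
    obtain b \<sigma> where p: "p = (b, \<sigma>)" by (cases p)
    have "\<sigma> h' = h'" using that p basics by (auto simp: conn_perms_def permutes_def)
    then have "(transpose h' b \<circ> \<sigma>) h' = b" by simp
    moreover have "transpose h' b \<circ> (transpose h' b \<circ> \<sigma>) = \<sigma>" by (simp add: comp_assoc[symmetric])
    ultimately show ?thesis unfolding p Let_def attach_def by (simp add: tt del: comp_apply)
  qed
  show "(case let \<tau> = \<sigma> \<circ> transpose r h in (\<tau> h', transpose h' (\<tau> h') \<circ> \<tau>) of (b, \<sigma>) \<Rightarrow> attach r h h' b \<sigma>) = \<sigma>"
    for \<sigma>
    by (simp add: Let_def attach_def comp_assoc[symmetric]) (simp add: comp_assoc)
qed

text \<open>The complementary case, in which the root edge is an isthmus. \<open>B\<close>, the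
  half-edges of the first component, is what stays reachable from \<open>r\<close> besides
  \<open>r\<close>, so the result determines the data.\<close>

lemma bij_bridge:
  "bij_betw (\<lambda>(B, \<alpha>, \<beta>). bridge r h \<alpha> \<beta>)
     (SIGMA B:{B. B \<subseteq> S \<and> m ` B \<subseteq> B}. conn_perms B m r \<times> conn_perms (S - B) m h')
     {\<sigma> \<in> conn_perms A m r. \<sigma> r = h \<and> h' \<notin> reach S m (\<sigma> \<circ> transpose r h) r}"
    (is "bij_betw ?f ?X ?Z")
proof (rule bij_betwI[where g = "\<lambda>\<sigma>. let \<tau> = \<sigma> \<circ> transpose r h; D = reach S m \<tau> r
      in (D - {r}, perm_restrict \<tau> D, perm_restrict \<tau> (Y - D))"])
  have tt: "f \<circ> transpose r h \<circ> transpose r h = f" for f :: "'a \<Rightarrow> 'a"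
    by (simp add: comp_assoc)
  let ?g = "\<lambda>\<sigma>. let \<tau> = \<sigma> \<circ> transpose r h; D = reach S m \<tau> r
      in (D - {r}, perm_restrict \<tau> D, perm_restrict \<tau> (Y - D))"
  show "?f \<in> ?X \<rightarrow> ?Z"
  proof
    fix p assume "p \<in> ?X"
    then obtain B \<alpha> \<beta> where p: "p = (B, \<alpha>, \<beta>)" and B: "B \<subseteq> S" "m ` B \<subseteq> B"
      and \<alpha>: "\<alpha> \<in> conn_perms B m r" and \<beta>: "\<beta> \<in> conn_perms (S - B) m h'" by auto
    note J = bridge_conn[OF B \<alpha> \<beta>]
    have "h' \<notin> insert r B" using B basics(6) by auto
    then show "?f p \<in> ?Z"
      using J(1,3) glue_permutes(2)[OF J(2)] by (simp add: p bridge_def tt del: comp_apply)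
  qed
  have Z: "?g \<sigma> \<in> ?X \<and> ?f (?g \<sigma>) = \<sigma>" if \<sigma>: "\<sigma> \<in> ?Z" for \<sigma>
  proof -
    let ?t = "\<sigma> \<circ> transpose r h"
    have t: "?t permutes Y" using \<sigma> by (intro cut_permutes) (auto simp: conn_perms_def)
    have "?t \<circ> transpose r h \<in> conn_perms A m r" using \<sigma> by (simp add: tt)
    then have Y: "Y \<subseteq> reach S m ?t r \<union> reach S m ?t h'" using conn_glue_iff[OF t] by auto
    have h': "h' \<notin> reach S m ?t r" using \<sigma> by auto
    show ?thesis
      using split_conn[OF t Y h'] unfolding Let_def bridge_def by (simp add: tt del: comp_apply)
  qed
  then show "?g \<in> ?Z \<rightarrow> ?X" "\<And>\<sigma>. \<sigma> \<in> ?Z \<Longrightarrow> ?f (?g \<sigma>) = \<sigma>" by blast+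
  show "?g (?f p) = p" if "p \<in> ?X" for p
  proof -
    obtain B \<alpha> \<beta> where p: "p = (B, \<alpha>, \<beta>)" by (cases p)
    note * = that[unfolded p]
    have B: "B \<subseteq> S" "m ` B \<subseteq> B" and \<alpha>: "\<alpha> \<in> conn_perms B m r" and \<beta>: "\<beta> \<in> conn_perms (S - B) m h'"
      using * by auto
    note J = bridge_conn[OF B \<alpha> \<beta>]
    have "perm_restrict (\<alpha> \<circ> \<beta>) (insert r B) = \<alpha>"
      using \<alpha> J(4) by (auto simp: perm_restrict_def fun_eq_iff conn_perms_def permutes_def simp del: comp_apply)
    moreover have "perm_restrict (\<alpha> \<circ> \<beta>) (Y - insert r B) = \<beta>"
    proof
      fix x
      show "perm_restrict (\<alpha> \<circ> \<beta>) (Y - insert r B) x = \<beta> x"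
      proof (cases "x \<in> Y - insert r B")
        case True
        then show ?thesis using J(5)[of x] by (simp add: perm_restrict_def)
      next
        case False
        then have "x \<notin> insert h' (S - B)" using B basics r_notin by auto
        moreover have "\<beta> permutes insert h' (S - B)" using \<beta> by (simp add: conn_perms_def)
        ultimately have "\<beta> x = x" by (metis permutes_not_in)
        then show ?thesis unfolding perm_restrict_def using False by (simp only: if_False)
      qed
    qed
    moreover have "insert r B - {r} = B" using B r_notin by auto
    ultimately show ?thesis unfolding p Let_def bridge_def by (simp add: tt J(3) del: comp_apply)
  qed
qed

end

section \<open>Maps represented by permutations\<close>

lemma first_return_bij:
  assumes "f permutes X" "finite X" "S \<subseteq> X"
  shows "bij_betw (first_return f S) S S"
proof -
  have fin: "finite S" using assms finite_subset by blast
  have "first_return f S ` S \<subseteq> S"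
    using permutes_returns[OF assms(1,2)] by (auto intro: first_return_in)
  moreover have "S \<subseteq> first_return f S ` S"
  proof
    fix y assume y: "y \<in> S"
    obtain k where "(f ^^ Suc k) y = y" by (rule permutes_return[OF assms(1,2)])
    then obtain j where "j > 0" "(first_return f S ^^ j) y = y"
      using first_return_funpow_pos[of "Suc k" f y S] y by auto
    then obtain i where i: "(first_return f S ^^ Suc i) y = y" by (cases j) auto
    have "(first_return f S ^^ n) y \<in> S" for n
      using y calculation by (induction n) auto
    then have "first_return f S ((first_return f S ^^ i) y) \<in> first_return f S ` S" by (rule imageI)
    then show "y \<in> first_return f S ` S" using i by simp
  qed
  ultimately have "first_return f S ` S = S" by auto
  then show ?thesis using fin by (simp add: bij_betw_def eq_card_imp_inj_on)
qed

lemma funpow_transfer: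
  assumes "\<And>y. y \<in> A \<Longrightarrow> f y \<in> A \<and> f' (g y) = g (f y)" "x \<in> A"
  shows "(f ^^ k) x \<in> A \<and> (f' ^^ k) (g x) = g ((f ^^ k) x)"
  using assms by (induction k) auto

lemma first_return_transfer:
  assumes "\<And>y. y \<in> A \<Longrightarrow> f y \<in> A \<and> f' (g y) = g (f y)" "inj_on g A" "S \<subseteq> A" "x \<in> A"
  shows "first_return f' (g ` S) (g x) = g (first_return f S x)"
proof -
  have *: "(f ^^ k) x \<in> A \<and> (f' ^^ k) (g x) = g ((f ^^ k) x)" for k
    using funpow_transfer[of A f f' g x k] assms(1,4) by auto
  have "(f' ^^ k) (g x) \<in> g ` S \<longleftrightarrow> (f ^^ k) x \<in> S" for k
    using * assms(2,3) by (auto simp: inj_on_image_mem_iff)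
  then show ?thesis unfolding first_return_def using * by simp
qed

text \<open>
  The half-edges of \<open>M\<close> are labelled by \<open>A\<close> through \<open>g\<close>. The set \<open>P\<close> consists of phantom half-edges, which
  \<open>\<sigma>\<close> rotates but \<open>M\<close> skips; \<open>w\<close> maps a (phantom) half-edge to its vertex. Deleting an edge
  just moves its two halves from \<open>A\<close> to \<open>P\<close>.
\<close>

definition represents :: "('v, 'h) rooted_cmap \<Rightarrow> 'a set \<Rightarrow> 'a set \<Rightarrow> ('a \<Rightarrow> 'a) \<Rightarrow> 'a \<Rightarrow> ('a \<Rightarrow> 'a)
    \<Rightarrow> ('a \<Rightarrow> 'h) \<Rightarrow> ('a \<Rightarrow> 'v) \<Rightarrow> bool" where
  "represents M A P m r \<sigma> g w \<longleftrightarrow>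
     finite P \<and> A \<inter> P = {} \<and> r \<in> P \<and> matching m A \<and> inj_on g A \<and> \<sigma> permutes (A \<union> P) \<and>
     verts M = w ` (A \<union> P) \<and> half_edges M = g ` A \<and>
     (\<forall>x\<in>A. vert_of M (g x) = w x \<and> mate M (g x) = g (m x) \<and> rot M (g x) = g (first_return \<sigma> A x)) \<and>
     (\<forall>x\<in>A \<union> P. \<forall>y\<in>A \<union> P. w x = w y \<longleftrightarrow> (\<exists>k. (\<sigma> ^^ k) x = y)) \<and>
     root_corner M = (if \<exists>x\<in>A. w x = w r then Before (g (first_return \<sigma> A r)) else Bare (w r))"

lemma representsD:
  assumes "represents M A P m r \<sigma> g w"
  shows "finite P" "A \<inter> P = {}" "r \<in> P" "matching m A" "inj_on g A" "\<sigma> permutes (A \<union> P)"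
     "verts M = w ` (A \<union> P)" "half_edges M = g ` A"
     "\<And>x. x \<in> A \<Longrightarrow> vert_of M (g x) = w x" "\<And>x. x \<in> A \<Longrightarrow> mate M (g x) = g (m x)"
     "\<And>x. x \<in> A \<Longrightarrow> rot M (g x) = g (first_return \<sigma> A x)"
     "\<And>x y. x \<in> A \<union> P \<Longrightarrow> y \<in> A \<union> P \<Longrightarrow> w x = w y \<longleftrightarrow> (\<exists>k. (\<sigma> ^^ k) x = y)"
     "root_corner M = (if \<exists>x\<in>A. w x = w r then Before (g (first_return \<sigma> A r)) else Bare (w r))"
     "finite (A \<union> P)" "\<And>x. x \<in> A \<Longrightarrow> m x \<in> A" "\<And>x. x \<in> A \<Longrightarrow> m (m x) = x" "\<And>x. x \<in> A \<Longrightarrow> m x \<noteq> x"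
     "finite A"
  using assms unfolding represents_def matching_def by (blast, blast, blast, blast, blast, blast, blast, blast, blast,
    blast, blast, blast, blast, blast, blast, blast, blast, blast)

lemma represents_rot_vertex:
  assumes "represents M A P m r \<sigma> g w" "x \<in> A \<union> P"
  shows "\<sigma> x \<in> A \<union> P" "w (\<sigma> x) = w x"
proof -
  note R = representsD[OF assms(1)]
  show *: "\<sigma> x \<in> A \<union> P" using assms(2) permutes_in_image[OF R(6)] by simp
  show "w (\<sigma> x) = w x" using R(12)[OF assms(2) *] by (metis funpow_0 funpow.simps(2) comp_apply)
qed

lemma represents_reach_subset:
  assumes "represents M A P m r \<sigma> g w"
  shows "reach A m \<sigma> r \<subseteq> A \<union> P"
  by (rule reach_least) (use representsD[OF assms] represents_rot_vertex[OF assms] in auto)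

section \<open>Graph connectivity in terms of reachability\<close>

lemma adj_represents:
  assumes "represents M A P m r \<sigma> g w"
  shows "adj M = (\<lambda>x. (w x, w (m x))) ` A"
proof -
  note R = representsD[OF assms]
  have "vert_of M (mate M (g x)) = w (m x)" if "x \<in> A" for x
    using that R(9,10,15) by simp
  then show ?thesis unfolding adj_def R(8) using R(9) by force
qed

lemma adj_reach_iff:
  assumes "represents M A P m r \<sigma> g w" "x \<in> A \<union> P"
  shows "(w r, w x) \<in> (adj M)\<^sup>* \<longleftrightarrow> x \<in> reach A m \<sigma> r"
proof
  note R = representsD[OF assms(1)] and adj = adj_represents[OF assms(1)]
  \<comment> \<open>The induction covers all half-edges at \<open>v\<close>, since a path in the
    graph may leave a vertex by another half-edge than the one by which it came; the rotation
    connects them.\<close>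
  have "\<forall>x\<in>A \<union> P. w x = v \<longrightarrow> x \<in> reach A m \<sigma> r" if "(w r, v) \<in> (adj M)\<^sup>*" for v
    using that
  proof (induction rule: rtrancl_induct)
    case base
    then show ?case using R(3,12) reach_funpow[OF reach.base] by (metis UnI2)
  next
    case (step u v)
    then obtain y where y: "y \<in> A" "u = w y" "v = w (m y)" by (auto simp: adj)
    then have "y \<in> reach A m \<sigma> r" using step.IH by auto
    then have "m y \<in> reach A m \<sigma> r" using y(1) by (rule reach.mate)
    then show ?case using y R(12,15) reach_funpow by (metis UnI1)
  qed
  then show "(w r, w x) \<in> (adj M)\<^sup>* \<Longrightarrow> x \<in> reach A m \<sigma> r" using assms(2) by blast
  assume "x \<in> reach A m \<sigma> r"
  then show "(w r, w x) \<in> (adj M)\<^sup>*"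
  proof induction
    case (rot x)
    then have "x \<in> A \<union> P" using represents_reach_subset[OF assms(1)] by auto
    then show ?case using rot represents_rot_vertex[OF assms(1)] by simp
  next
    case (mate x)
    then have "(w x, w (m x)) \<in> adj M" unfolding adj by blast
    then show ?case using mate by (meson rtrancl.rtrancl_into_rtrancl)
  qed simp
qed

lemma sym_adj:
  assumes "represents M A P m r \<sigma> g w"
  shows "sym ((adj M)\<^sup>*)"
proof (intro sym_rtrancl symI)
  note R = representsD[OF assms]
  fix u v assume "(u, v) \<in> adj M"
  then obtain x where x: "x \<in> A" "u = w x" "v = w (m x)" by (auto simp: adj_represents[OF assms])
  then have "(v, u) = (w (m x), w (m (m x)))" "m x \<in> A" using R(15,16) by auto
  then show "(v, u) \<in> adj M" unfolding adj_represents[OF assms] by blast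
qed

lemma card_conn_components_connected:
  assumes "represents M A P m r \<sigma> g w" "A \<union> P \<subseteq> reach A m \<sigma> r"
  shows "card (conn_components M) = 1"
proof -
  note R = representsD[OF assms(1)]
  let ?E = "(adj M)\<^sup>* \<inter> verts M \<times> verts M"
  have root: "(w r, v) \<in> (adj M)\<^sup>*" if "v \<in> verts M" for v
    using that assms(2) adj_reach_iff[OF assms(1)] unfolding R(7) by blast
  have "?E `` {v} = verts M" if v: "v \<in> verts M" for v
  proof -
    have "(v, u) \<in> (adj M)\<^sup>*" if "u \<in> verts M" for u
      using root[OF v] root[OF that] sym_adj[OF assms(1)] by (meson rtrancl_trans symD)
    then show ?thesis using v by auto
  qed
  moreover have "verts M \<noteq> {}" using R(3,7) by auto
  ultimately have "conn_components M = {verts M}"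
    unfolding conn_components_def quotient_def by auto
  then show ?thesis by simp
qed

lemma card_conn_components_disconnected:
  assumes "represents M A P m r \<sigma> g w" "\<not> A \<union> P \<subseteq> reach A m \<sigma> r"
  shows "card (conn_components M) > 1"
proof -
  note R = representsD[OF assms(1)]
  let ?E = "(adj M)\<^sup>* \<inter> verts M \<times> verts M"
  obtain x where x: "x \<in> A \<union> P" "x \<notin> reach A m \<sigma> r" using assms(2) by auto
  then have n: "(w r, w x) \<notin> (adj M)\<^sup>*" using adj_reach_iff[OF assms(1)] by blast
  have v: "w r \<in> verts M" "w x \<in> verts M" using R(3,7) x by auto
  have "finite (conn_components M)"
    unfolding conn_components_def quotient_def using R(7,14) by auto
  moreover have "{?E `` {w r}, ?E `` {w x}} \<subseteq> conn_components M"
    using v unfolding conn_components_def quotient_def by blast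
  moreover have "?E `` {w r} \<noteq> ?E `` {w x}" using n v by blast
  ultimately have "card {?E `` {w r}, ?E `` {w x}} \<le> card (conn_components M)"
    by (intro card_mono)
  then show ?thesis using \<open>?E `` {w r} \<noteq> ?E `` {w x}\<close> by simp
qed

lemma represents_root_returns:
  assumes M: "represents M A P m r \<sigma> g w" and ex: "\<exists>x\<in>A. w x = w r"
  shows "returns \<sigma> A r"
proof -
  note R = representsD[OF M]
  obtain x where x: "x \<in> A" "w r = w x" using ex by metis
  then obtain k where k: "(\<sigma> ^^ k) r = x" using R(12)[of r x] R(3) by auto
  have "k \<noteq> 0" using k x R(2,3) by (cases k) auto
  then show ?thesis unfolding returns_def using k x by auto
qed

text \<open>A phantom other than \<open>r\<close> leaves no trace in the record, except that it may
  keep a vertex alive. If something else lies at its vertex, the rotation can skip it while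
  \<open>M\<close> stays the same.\<close>

lemma represents_remove_phantom:
  assumes M: "represents M A (insert p P) m r \<sigma> g w" and p: "p \<notin> P" "p \<noteq> r"
    and x: "\<exists>x\<in>A \<union> P. w x = w p"
    and \<tau>: "\<tau> permutes (A \<union> P)" "\<And>x. x \<in> A \<union> P \<Longrightarrow> \<tau> x = first_return \<sigma> (A \<union> P) x"
  shows "represents M A P m r \<tau> g w"
proof -
  note R = representsD[OF M]
  let ?X = "A \<union> P"
  have pA: "p \<notin> A" using R(2) by auto
  have rP: "r \<in> P" using R(3) p by auto
  have \<tau>X: "\<tau> y \<in> ?X \<and> first_return \<sigma> ?X y = \<tau> y" if "y \<in> ?X" for y
    using \<tau>(2)[OF that] permutes_in_image[OF \<tau>(1), of y] that by metis
  have ret: "first_return \<tau> A x = first_return \<sigma> A x" if "x \<in> ?X" "returns \<sigma> A x" for x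
  proof -
    have "first_return \<tau> A x = first_return (first_return \<sigma> ?X) A x"
      using that(1) \<tau>X by (rule first_return_cong) auto
    also have "\<dots> = first_return \<sigma> A x" using that by (intro first_return_first_return) auto
    finally show ?thesis .
  qed
  have pow: "(\<exists>k. (\<tau> ^^ k) x = y) \<longleftrightarrow> (\<exists>k. (\<sigma> ^^ k) x = y)" if "x \<in> ?X" "y \<in> ?X" for x y
  proof -
    have "(\<tau> ^^ k) x = (first_return \<sigma> ?X ^^ k) x" for k
      using funpow_transfer[of ?X \<tau> "first_return \<sigma> ?X" "\<lambda>x. x" x k] that(1) \<tau>X by metis
    then show ?thesis using first_return_funpow_iff[OF that, of \<sigma>] by simp
  qed
  have retA: "returns \<sigma> A x" if "x \<in> A" for x using permutes_returns[OF R(6,14) that] .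
  have retr: "returns \<sigma> A r" if "\<exists>x\<in>A. w x = w r"
    using represents_root_returns[OF M that] .
  show ?thesis unfolding represents_def
  proof (intro conjI)
    have "w p \<in> w ` ?X" using x by (metis imageI)
    then show "verts M = w ` ?X" using R(7) by auto
    show "\<forall>x\<in>A. vert_of M (g x) = w x \<and> mate M (g x) = g (m x) \<and> rot M (g x) = g (first_return \<tau> A x)"
      using R(9,10,11) ret retA by simp
    show "\<forall>x\<in>?X. \<forall>y\<in>?X. (w x = w y) = (\<exists>k. (\<tau> ^^ k) x = y)"
      using R(12) pow by simp
    show "root_corner M = (if \<exists>x\<in>A. w x = w r then Before (g (first_return \<tau> A r)) else Bare (w r))"
      using R(13) ret[of r] rP retr by auto
  qed (use R(1,2,4,5,8) rP \<tau>(1) in auto)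
qed

lemma represents_component:
  assumes M: "represents M A P m r \<sigma> g w" 
  defines "D \<equiv> reach A m \<sigma> r"
  shows "represents (component_of M (w r)) (A \<inter> D) (P \<inter> D) m r (perm_restrict \<sigma> D) g w"
proof -
  note R = representsD[OF M]
  have DX: "D \<subseteq> A \<union> P" unfolding D_def by (rule represents_reach_subset[OF M])
  have rD: "r \<in> D" unfolding D_def by (rule reach.base)
  have AP: "A \<inter> D \<union> P \<inter> D = D" using DX by auto
  have step: "\<sigma> x \<in> D" if "x \<in> D" for x using that unfolding D_def by (rule reach.rot)
  have perm: "perm_restrict \<sigma> D permutes D"
    using R(6,14) DX step by (rule perm_restrict_permutes)
  have reach: "(w r, w x) \<in> (adj M)\<^sup>* \<longleftrightarrow> x \<in> D" if "x \<in> A \<union> P" for x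
    using adj_reach_iff[OF M that] by (simp add: D_def)
  have verts: "verts (component_of M (w r)) = w ` D"
    using reach DX by (auto simp: component_of_def R(7))
  have halves: "half_edges (component_of M (w r)) = g ` (A \<inter> D)"
    using reach R(9) by (auto simp: component_of_def R(8))
  have fr: "first_return \<sigma> A x = first_return (perm_restrict \<sigma> D) (A \<inter> D) x" if "x \<in> D" for x
    by (rule first_return_cong[of _ D]) (use that step in \<open>auto simp: perm_restrict_def\<close>)
  have pow: "(perm_restrict \<sigma> D ^^ k) x = (\<sigma> ^^ k) x" if "x \<in> D" for x k
    using funpow_transfer[of D \<sigma> "perm_restrict \<sigma> D" "\<lambda>x. x" x k] that step by (auto simp: perm_restrict_def)
  have mD: "m ` (A \<inter> D) \<subseteq> A \<inter> D" using R(15) by (auto simp: D_def intro: reach.mate)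
  have root: "(\<exists>x\<in>A. w x = w r) \<longleftrightarrow> (\<exists>x\<in>A \<inter> D. w x = w r)"
    using reach by (metis IntD1 IntI UnI1 rtrancl.rtrancl_refl)
  show ?thesis unfolding represents_def AP
  proof (intro conjI)
    show "matching m (A \<inter> D)" using R(4) mD by (rule matching_subset[OF _ Int_lower1])
    show "root_corner (component_of M (w r)) = (if \<exists>x\<in>A \<inter> D. w x = w r
        then Before (g (first_return (perm_restrict \<sigma> D) (A \<inter> D) r)) else Bare (w r))"
      using R(13) root fr[OF rD] by (simp add: component_of_def)
    show "\<forall>x\<in>D. \<forall>y\<in>D. (w x = w y) = (\<exists>k. (perm_restrict \<sigma> D ^^ k) x = y)"
      using R(12) DX pow by (metis subsetD)
    show "\<forall>x\<in>A \<inter> D. vert_of (component_of M (w r)) (g x) = w x \<and>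
        mate (component_of M (w r)) (g x) = g (m x) \<and>
        rot (component_of M (w r)) (g x) = g (first_return (perm_restrict \<sigma> D) (A \<inter> D) x)"
      using R(9,10,11) fr by (auto simp: component_of_def)
  qed (use R(1,2,3,5) rD perm verts halves in \<open>auto intro: inj_on_subset\<close>)
qed

lemma represents_is_rooted_cmap:
  assumes M: "represents M A {r} m r \<sigma> g w" and conn: "insert r A \<subseteq> reach A m \<sigma> r"
  shows "is_rooted_cmap M"
proof -
  note R = representsD[OF M]
  have bij: "bij_betw (first_return \<sigma> A) A A" using R(6,14) by (rule first_return_bij) auto
  have fr: "first_return \<sigma> A x \<in> A \<and> rot M (g x) = g (first_return \<sigma> A x)" if "x \<in> A" for x
    using that R(11) bij by (auto simp: bij_betw_def)
  have pow: "(first_return \<sigma> A ^^ k) x \<in> A \<and> (rot M ^^ k) (g x) = g ((first_return \<sigma> A ^^ k) x)"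
    if "x \<in> A" for x k
    using funpow_transfer[of A "first_return \<sigma> A" "rot M" g x k] fr that by auto
  have "bij_betw (rot M) (g ` A) (g ` A)"
  proof -
    have "bij_betw g A (g ` A)" using R(5) by (simp add: bij_betw_def)
    then have "bij_betw (g \<circ> first_return \<sigma> A \<circ> inv_into A g) (g ` A) (g ` A)"
      using bij by (metis bij_betw_inv_into bij_betw_trans)
    then show ?thesis
      by (rule bij_betw_cong[THEN iffD1, rotated]) (use fr R(5) in auto)
  qed
  moreover have "vert_of M (g x) = vert_of M (g y) \<longleftrightarrow> (\<exists>k. (rot M ^^ k) (g x) = g y)"
    if "x \<in> A" "y \<in> A" for x y
  proof -
    have "vert_of M (g x) = vert_of M (g y) \<longleftrightarrow> (\<exists>k. (first_return \<sigma> A ^^ k) x = y)"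
      using that R(9,12) first_return_funpow_iff[OF that, of \<sigma>] by simp
    also have "\<dots> \<longleftrightarrow> (\<exists>k. (rot M ^^ k) (g x) = g y)"
      using pow[OF that(1)] that(2) R(5) by (metis inj_onD)
    finally show ?thesis .
  qed
  moreover have "card (conn_components M) = 1"
    using card_conn_components_connected[OF M] conn by simp
  moreover have "mate M (g x) \<in> g ` A \<and> mate M (g x) \<noteq> g x \<and> mate M (mate M (g x)) = g x" if "x \<in> A" for x
    using that R(5,10,15,16,17) by (auto simp: inj_on_eq_iff)
  ultimately have "is_cmap M"
    unfolding is_cmap_def using R(7,8,9,14,18) by auto
  moreover have "root_corner M \<in> corners M"
  proof (cases "\<exists>x\<in>A. w x = w r")
    case True
    then have "first_return \<sigma> A r \<in> A"
      by (intro first_return_in represents_root_returns[OF M])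
    then show ?thesis using True R(8,13) by (auto simp: corners_def)
  next
    case False
    then have "w r \<notin> vert_of M ` g ` A" using R(9) by force
    then show ?thesis using False R(7,8,13) by (auto simp: corners_def)
  qed
  ultimately show ?thesis by (simp add: is_rooted_cmap_def)
qed

lemma represents_card_edges:
  assumes M: "represents M A P m r \<sigma> g w"
  shows "2 * card (edges M) = card A"
proof -
  note R = representsD[OF M]
  have E: "edges M = (\<lambda>x. {g x, g (m x)}) ` A" using R(8,10) by (force simp: edges_def)
  have "2 * card (edges M) = card (\<Union> (edges M))"
  proof (rule card_partition)
    show "finite (edges M)" "finite (\<Union> (edges M))" using R(18) by (auto simp: E)
    show "card c = 2" if c: "c \<in> edges M" for c
    proof -
      obtain x where "x \<in> A" "c = {g x, g (m x)}" using c by (auto simp: E)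
      moreover have "g x \<noteq> g (m x)" using R(5,15,17) calculation by (metis inj_on_eq_iff)
      ultimately show ?thesis by simp
    qed
    show "c \<inter> c' = {}" if c: "c \<in> edges M" "c' \<in> edges M" "c \<noteq> c'" for c c'
    proof -
      obtain x y where xy: "x \<in> A" "y \<in> A" "c = {g x, g (m x)}" "c' = {g y, g (m y)}"
        using c by (auto simp: E)
      then have "x \<noteq> y" "x \<noteq> m y" using c(3) R(16) by auto
      then have "m x \<noteq> y" "m x \<noteq> m y" using xy R(16) by metis+
      then show ?thesis using xy \<open>x \<noteq> y\<close> \<open>x \<noteq> m y\<close> R(5,15) by (auto simp: inj_on_eq_iff)
    qed
  qed
  also have "\<Union> (edges M) = g ` A" using R(15) by (auto simp: E)
  also have "card (g ` A) = card A" using R(5) by (rule card_image)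
  finally show ?thesis .
qed

section \<open>Deletion of the root edge, on records and on permutations\<close>

context root_edge
begin

text \<open>Conjugating the transposition by \<open>\<tau>\<close>, which fixes \<open>h\<close>,
  moves it to the left, the form in which \<open>first_return_insert\<close> recognises an
  insertion.\<close>

lemma glue_eq_insert:
  assumes "\<tau> permutes Y"
  shows "\<tau> \<circ> transpose r h = transpose h (\<tau> r) \<circ> \<tau>"
proof
  fix x
  have "\<tau> h = h" using assms basics(2,3,5) by (auto simp: permutes_def)
  moreover have "\<tau> x = \<tau> y \<longleftrightarrow> x = y" for x y using assms by (metis permutes_inj injD)
  ultimately show "(\<tau> \<circ> transpose r h) x = (transpose h (\<tau> r) \<circ> \<tau>) x"
    by (metis comp_apply transpose_apply_first transpose_apply_second transpose_apply_other)
qed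

text \<open>Deletion is followed in two stages: both halves of the edge become phantoms under the
  unchanged rotation, and then \<open>h\<close> is dropped, which is possible because
  \<open>r\<close> shares its vertex. \<open>h'\<close> stays, for it may be alone at its
  vertex.\<close>

lemma represents_cut:
  assumes M: "represents M A {r} m r (\<tau> \<circ> transpose r h) g w" and \<tau>: "\<tau> permutes Y"
  shows "root_corner M = Before (g h)" "vert_of M (g h) = w r"
    "represents (delete_root_edge M (g h)) S {r, h'} m r \<tau> g w"
proof -
  let ?s = "\<tau> \<circ> transpose r h" and ?M = "delete_root_edge M (g h)"
  note R = representsD[OF M]
  have \<sigma>r: "?s r = h" using glue_permutes(2)[OF \<tau>] .
  have wh: "w h = w r" using represents_rot_vertex(2)[OF M, of r] \<sigma>r by simp
  have fr: "first_return ?s A r = h" using \<sigma>r h_in by (metis first_return_now)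
  show "root_corner M = Before (g h)" using R(13) wh h_in fr by auto
  show vh: "vert_of M (g h) = w r" using R(9) h_in wh by simp
  have SA: "S \<subseteq> A" by auto
  have halves: "g ` A - {g h, mate M (g h)} = g ` S"
    using R(5,10) h_in basics(2) by (auto simp: inj_on_eq_iff)
  have frA: "first_return ?s A x \<in> A \<and> rot M (g x) = g (first_return ?s A x)" if "x \<in> A" for x
    using R(11) that first_return_bij[OF R(6,14), of A] by (auto simp: bij_betw_def)
  have rot: "first_return (rot M) (g ` S) (g x) = g (first_return ?s S x)"
    if "x \<in> A" "returns ?s S x" for x
    using first_return_transfer[of A "first_return ?s A" "rot M" g S x] frA R(5) SA that(1)
      first_return_first_return[OF SA that(2)] by simp
  have U': "A \<union> {r} = S \<union> {h, r, h'}" using h_in basics(2) by auto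
  have root: "root_corner ?M = (if \<exists>x\<in>S. w x = w r then Before (g (first_return ?s S r)) else Bare (w r))"
  proof -
    have "vert_of M ` (g ` S) = w ` S" using R(9) SA by (force simp: image_iff)
    then have "root_corner ?M = (if w r \<in> w ` S
        then Before (first_return (rot M) (g ` S) (g h)) else Bare (w r))"
      by (simp add: delete_root_edge_def corner_left_def R(8) halves vh Let_def)
    \<comment> \<open>\<open>corner_left\<close> starts at \<open>h\<close>, whereas
      \<open>represents\<close> starts at \<open>r\<close>; both find the same half-edge, since
      \<open>h\<close> follows \<open>r\<close> and is not in \<open>S\<close>.\<close>
    moreover have "first_return (rot M) (g ` S) (g h) = g (first_return ?s S r)" if x: "x \<in> S" "w x = w r" for x
    proof -
      have "w h = w x" using x wh by simp
      then obtain k where k: "(?s ^^ k) h = x" using R(12)[of h x] h_in x by auto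
      have "k \<noteq> 0" using k x by (cases k) auto
      then have ret: "returns ?s S h" using k x by (auto simp: returns_def)
      then have "first_return ?s S r = first_return ?s S h"
        using \<sigma>r by (metis DiffD2 first_return_later insertI1 returns_Suc)
      then show ?thesis using rot[OF h_in ret] by simp
    qed
    moreover have "w r \<in> w ` S \<longleftrightarrow> (\<exists>x\<in>S. w x = w r)" by (auto simp: image_iff eq_commute[of "w r"])
    ultimately show ?thesis by auto
  qed
  have "represents ?M S {h, r, h'} m r ?s g w"
    unfolding represents_def
  proof (intro conjI)
    show "inj_on g S" using R(5) by (rule inj_on_subset) auto
    show "half_edges ?M = g ` S" by (simp add: delete_root_edge_def delete_edge_def R(8) halves)
    show "verts ?M = w ` (S \<union> {h, r, h'})"
    proof -
      have "verts ?M = w ` (A \<union> {r})" using R(7) by (simp add: delete_root_edge_def delete_edge_def)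
      also note U'
      finally show ?thesis .
    qed
    show "\<forall>x\<in>S. vert_of ?M (g x) = w x \<and> mate ?M (g x) = g (m x) \<and> rot ?M (g x) = g (first_return ?s S x)"
      using R(9,10) rot permutes_returns[OF R(6,14)]
      by (simp add: delete_root_edge_def delete_edge_def R(8) halves)
    show "\<forall>x\<in>S \<union> {h, r, h'}. \<forall>y\<in>S \<union> {h, r, h'}. (w x = w y) = (\<exists>k. (?s ^^ k) x = y)"
      unfolding U'[symmetric] using R(12) by blast
  qed (use matching_S r_notin root R(6)[unfolded U'] in auto)
  then show "represents ?M S {r, h'} m r \<tau> g w"
  proof (rule represents_remove_phantom)
    have *: "S \<union> {r, h'} = Y" by auto
    show "\<tau> permutes S \<union> {r, h'}" using \<tau> by (simp only: *)
    show "\<tau> x = first_return ?s (S \<union> {r, h'}) x" if "x \<in> S \<union> {r, h'}" for x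
    proof -
      have "\<tau> r \<in> Y" using permutes_in_image[OF \<tau>, of r] by simp
      then show ?thesis unfolding glue_eq_insert[OF \<tau>] *
        using that by (subst first_return_insert[OF \<tau>]) (use basics(3,5) in auto)
    qed
    show "\<exists>x\<in>S \<union> {r, h'}. w x = w h" using wh by auto
  qed (use basics in auto)
qed

lemma isthmus_cut:
  assumes M: "represents M A {r} m r (\<tau> \<circ> transpose r h) g w" and \<tau>: "\<tau> permutes Y"
    and conn: "\<tau> \<circ> transpose r h \<in> conn_perms A m r"
  shows "isthmus M (g h) \<longleftrightarrow> \<not> Y \<subseteq> reach S m \<tau> r"
proof -
  have "card (conn_components M) = 1"
    using card_conn_components_connected[OF M] conn by (simp add: conn_perms_def)
  moreover have "conn_components (delete_root_edge M (g h)) = conn_components (delete_edge M (g h))"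
    by (simp add: conn_components_def delete_root_edge_def adj_def)
  moreover have "S \<union> {r, h'} = Y" by auto
  ultimately show ?thesis
    using card_conn_components_connected[OF represents_cut(3)[OF M \<tau>]]
      card_conn_components_disconnected[OF represents_cut(3)[OF M \<tau>]]
    unfolding isthmus_def by (metis less_irrefl)
qed

lemma h_half_edge:
  assumes "represents M A {r} m r \<sigma> g w"
  shows "g h \<in> half_edges M" "finite (half_edges M)"
  using representsD(8,18)[OF assms] h_in by auto

lemma isthmic_parts_attach:
  assumes M: "represents M A {r} m r (attach r h h' b \<sigma>) g w"
    and \<sigma>: "\<sigma> \<in> conn_perms S m r" and b: "b \<in> insert r S"
  shows "isthmic_parts M = isthmic_parts (delete_root_edge M (g h))"
    "represents (delete_root_edge M (g h)) S {r} m r \<sigma> g w"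
proof -
  let ?t = "transpose h' b \<circ> \<sigma>"
  note AC = attach_conn[OF \<sigma> b]
  have M': "represents M A {r} m r (?t \<circ> transpose r h) g w" using M by (simp add: attach_def)
  note C = represents_cut[OF M' AC(2)]
  have p: "\<sigma> permutes insert r S" and c: "insert r S \<subseteq> reach S m \<sigma> r"
    using \<sigma> by (auto simp: conn_perms_def)
  have "Y \<subseteq> reach S m ?t r" using reach_attach[OF p b] b c by auto
  then have "\<not> isthmus M (g h)"
    using isthmus_cut[OF M' AC(2)] AC(1) by (simp add: attach_def)
  then show "isthmic_parts M = isthmic_parts (delete_root_edge M (g h))"
    using C(1) h_half_edge[OF M] by (subst isthmic_parts.simps) simp
  have "represents (delete_root_edge M (g h)) S (insert h' {r}) m r ?t g w"
    using C(3) by (simp add: insert_commute)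
  then show "represents (delete_root_edge M (g h)) S {r} m r \<sigma> g w"
  proof (rule represents_remove_phantom)
    have *: "S \<union> {r} = insert r S" by auto
    show "\<sigma> permutes S \<union> {r}" using p by (simp only: *)
    show "\<sigma> x = first_return ?t (S \<union> {r}) x" if "x \<in> S \<union> {r}" for x
      unfolding * using that b basics(6) by (subst first_return_insert[OF p]) auto
    \<comment> \<open>Inserted before \<open>b\<close>, the phantom \<open>h'\<close> lies at the
      vertex of \<open>b\<close>, so dropping it loses no vertex.\<close>
    have "\<sigma> h' = h'" using p basics(6) by (auto simp: permutes_def)
    then have "w b = w h'"
      using represents_rot_vertex(2)[OF C(3), of h'] by simp
    then show "\<exists>x\<in>S \<union> {r}. w x = w h'" using b by auto
  qed (use basics(6) in auto)
qed

lemma isthmic_parts_bridge: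
  assumes M: "represents M A {r} m r (bridge r h \<alpha> \<beta>) g w" and B: "B \<subseteq> S" "m ` B \<subseteq> B"
    and \<alpha>: "\<alpha> \<in> conn_perms B m r" and \<beta>: "\<beta> \<in> conn_perms (S - B) m h'"
  shows "isthmic_parts M = Suc (isthmic_parts (component_of (delete_root_edge M (g h)) (w r)))"
    "represents (component_of (delete_root_edge M (g h)) (w r)) B {r} m r \<alpha> g w"
proof -
  note J = bridge_conn[OF B \<alpha> \<beta>]
  have M': "represents M A {r} m r (\<alpha> \<circ> \<beta> \<circ> transpose r h) g w" using M by (simp add: bridge_def)
  note C = represents_cut[OF M' J(2)]
  have h': "h' \<notin> insert r B" using B basics(6) by auto
  then have "isthmus M (g h)"
    using isthmus_cut[OF M' J(2)] J(1) unfolding J(3) bridge_def by auto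
  then show "isthmic_parts M = Suc (isthmic_parts (component_of (delete_root_edge M (g h)) (w r)))"
    using C(1,2) h_half_edge[OF M] by (subst isthmic_parts.simps) simp
  have res: "perm_restrict (\<alpha> \<circ> \<beta>) (insert r B) = \<alpha>"
  proof
    fix x
    have "\<alpha> permutes insert r B" using \<alpha> by (simp add: conn_perms_def)
    then show "perm_restrict (\<alpha> \<circ> \<beta>) (insert r B) x = \<alpha> x"
      using J(4)[of x] permutes_not_in[of \<alpha> "insert r B" x] unfolding perm_restrict_def by presburger
  qed
  have int: "S \<inter> insert r B = B" "{r, h'} \<inter> insert r B = {r}" using B r_notin h' by auto
  show "represents (component_of (delete_root_edge M (g h)) (w r)) B {r} m r \<alpha> g w"
    using represents_component[OF C(3)] unfolding J(3) res int .
qed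

end

lemma conn_perms_fixed_root:
  assumes "\<sigma> \<in> conn_perms A m r" "\<sigma> r = r" "r \<notin> A"
  shows "A = {}"
proof -
  have "reach A m \<sigma> r \<subseteq> {r}" by (rule reach_least) (use assms in auto)
  then show ?thesis using assms by (auto simp: conn_perms_def)
qed

lemma isthmic_parts_empty:
  assumes "represents M {} {r} m r \<sigma> g w"
  shows "isthmic_parts M = 0"
  using representsD(13)[OF assms] by (subst isthmic_parts.simps) simp

text \<open>Two maps of possibly different types with the same permutations are taken apart in
  parallel. At an isthmus only the first component is followed, so the phantom root \<open>r\<close>
  never changes.\<close>

lemma isthmic_parts_unique:
  fixes M :: "('v, 'h) rooted_cmap" and N :: "('w, 'k) rooted_cmap"
  assumes "\<sigma> \<in> conn_perms A m r" "represents M A {r} m r \<sigma> g w" "represents N A {r} m r \<sigma> g' w'"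
  shows "isthmic_parts M = isthmic_parts N"
  using assms
proof (induction "card A" arbitrary: A \<sigma> M N g w g' w' rule: less_induct)
  case less
  note RM = representsD[OF less.prems(2)]
  show ?case
  proof (cases "\<sigma> r = r")
    case True
    then have "A = {}" using conn_perms_fixed_root[OF less.prems(1)] RM(2) by auto
    then show ?thesis using less.prems(2,3) isthmic_parts_empty by metis
  next
    case False
    define h where "h = \<sigma> r"
    have "h \<in> A" using False represents_rot_vertex(1)[OF less.prems(2), of r] by (auto simp: h_def)
    then interpret root_edge A m r h using RM(2,4) by unfold_locales auto
    show ?thesis
    proof (cases "h' \<in> reach S m (\<sigma> \<circ> transpose r h) r")
      case True
      then have "\<sigma> \<in> (\<lambda>(b, \<sigma>). attach r h h' b \<sigma>) ` (insert r S \<times> conn_perms S m r)"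
        using bij_betw_imp_surj_on[OF bij_attach] less.prems(1) h_def by blast
      then obtain b s where s: "\<sigma> = attach r h h' b s" "b \<in> insert r S" "s \<in> conn_perms S m r" by auto
      have "card S < card A" using RM(18) h_in by (intro psubset_card_mono) auto
      then show ?thesis
        using isthmic_parts_attach[OF less.prems(2)[unfolded s(1)] s(3,2)]
          isthmic_parts_attach[OF less.prems(3)[unfolded s(1)] s(3,2)] less.hyps s(3) by metis
    next
      case False
      then have "\<sigma> \<in> (\<lambda>(B, \<alpha>, \<beta>). bridge r h \<alpha> \<beta>) `
          (SIGMA B:{B. B \<subseteq> S \<and> m ` B \<subseteq> B}. conn_perms B m r \<times> conn_perms (S - B) m h')"
        using bij_betw_imp_surj_on[OF bij_bridge] less.prems(1) h_def by blast
      then obtain B \<alpha> \<beta> where s: "\<sigma> = bridge r h \<alpha> \<beta>" "B \<subseteq> S" "m ` B \<subseteq> B"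
          "\<alpha> \<in> conn_perms B m r" "\<beta> \<in> conn_perms (S - B) m h'" by auto
      have "card B < card A" using RM(18) h_in s(2) by (intro psubset_card_mono) auto
      then show ?thesis
        using isthmic_parts_bridge[OF less.prems(2)[unfolded s(1)] s(2-5)]
          isthmic_parts_bridge[OF less.prems(3)[unfolded s(1)] s(2-5)] less.hyps s(4) by metis
    qed
  qed
qed

section \<open>Counting labelled maps\<close>

definition pairs :: "('a \<Rightarrow> 'a) \<Rightarrow> 'a set \<Rightarrow> 'a set set" where
  "pairs m A = (\<lambda>x. {x, m x}) ` A"

lemma card_Union_pairs:
  assumes "matching m A" "F \<subseteq> pairs m A"
  shows "card (\<Union> F) = 2 * card F"
proof -
  have A: "finite A" "\<And>x. x \<in> A \<Longrightarrow> m x \<in> A \<and> m x \<noteq> x \<and> m (m x) = x"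
    using assms(1) by (auto simp: matching_def)
  have "2 * card F = card (\<Union> F)"
  proof (rule card_partition)
    have "F \<subseteq> Pow A" using assms(2) A by (auto simp: pairs_def)
    then show "finite F" "finite (\<Union> F)" using A(1) by (auto intro: finite_subset)
    show "card c = 2" if c: "c \<in> F" for c
    proof -
      obtain x where "x \<in> A" "c = {x, m x}" using c assms(2) by (auto simp: pairs_def)
      then show ?thesis using A(2)[of x] by (simp add: card_2_iff) metis
    qed
    show "c \<inter> c' = {}" if c: "c \<in> F" "c' \<in> F" "c \<noteq> c'" for c c'
    proof -
      obtain x y where xy: "x \<in> A" "y \<in> A" "c = {x, m x}" "c' = {y, m y}"
      proof -
        have "c \<in> (\<lambda>x. {x, m x}) ` A" "c' \<in> (\<lambda>x. {x, m x}) ` A"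
          using c(1,2) assms(2) by (auto simp: pairs_def)
        then show ?thesis using that by auto
      qed
      have "x \<noteq> y" using xy c(3) by auto
      moreover have "m x \<noteq> y" using xy c(3) A(2)[of x] by auto
      moreover have "x \<noteq> m y" using xy c(3) A(2)[of y] by auto
      moreover have "m x \<noteq> m y" using A(2)[OF xy(1)] A(2)[OF xy(2)] \<open>x \<noteq> y\<close> by metis
      ultimately show ?thesis using xy by auto
    qed
  qed
  then show ?thesis by simp
qed

lemma card_pairs:
  assumes "matching m A"
  shows "card A = 2 * card (pairs m A)"
proof -
  have "\<Union> (pairs m A) = A" using assms by (auto simp: pairs_def matching_def)
  then show ?thesis using card_Union_pairs[OF assms order_refl] by simp
qed

text \<open>A closed subset is a union of matched pairs, so the size 2i occurs as often as there are
  choices of i pairs.\<close>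

lemma sum_closed_subsets:
  fixes f :: "nat \<Rightarrow> nat"
  assumes m: "matching m A" and n: "card A = 2 * n"
  shows "(\<Sum>B | B \<subseteq> A \<and> m ` B \<subseteq> B. f (card B)) = (\<Sum>i\<le>n. (n choose i) * f (2 * i))"
proof -
  have A: "finite A" "\<And>x. x \<in> A \<Longrightarrow> m x \<in> A \<and> m x \<noteq> x \<and> m (m x) = x"
    using m by (auto simp: matching_def)
  let ?E = "pairs m A"
  have E: "finite ?E" "card ?E = n" using A(1) card_pairs[OF m] n by (auto simp: pairs_def)
  have "bij_betw \<Union> (Pow ?E) {B. B \<subseteq> A \<and> m ` B \<subseteq> B}"
  proof (rule bij_betwI[where g = "pairs m"])
    show "\<Union> \<in> Pow ?E \<rightarrow> {B. B \<subseteq> A \<and> m ` B \<subseteq> B}"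
    proof
      fix F assume F: "F \<in> Pow ?E"
      have "x \<in> A \<and> m x \<in> \<Union> F" if "x \<in> \<Union> F" for x
      proof -
        obtain c where c: "c \<in> F" "x \<in> c" using \<open>x \<in> \<Union> F\<close> by auto
        then obtain y where "y \<in> A" "c = {y, m y}" using F by (auto simp: pairs_def)
        then show ?thesis using c A(2)[of y] by auto
      qed
      then show "\<Union> F \<in> {B. B \<subseteq> A \<and> m ` B \<subseteq> B}" by auto
    qed
    show "pairs m \<in> {B. B \<subseteq> A \<and> m ` B \<subseteq> B} \<rightarrow> Pow ?E" unfolding pairs_def by blast
    show "pairs m (\<Union> F) = F" if F: "F \<in> Pow ?E" for F
    proof
      show "F \<subseteq> pairs m (\<Union> F)" 
      proof
        fix c assume "c \<in> F"
        moreover then obtain y where "y \<in> A" "c = {y, m y}" using F by (auto simp: pairs_def)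
        ultimately show "c \<in> pairs m (\<Union> F)" by (auto simp: pairs_def)
      qed
      show "pairs m (\<Union> F) \<subseteq> F"
      proof
        fix c assume "c \<in> pairs m (\<Union> F)"
        then obtain x d where x: "c = {x, m x}" "x \<in> d" "d \<in> F" by (auto simp: pairs_def)
        then obtain y where y: "y \<in> A" "d = {y, m y}" using F by (auto simp: pairs_def)
        then have "c = d" using x A(2)[of y] by auto
        then show "c \<in> F" using x by simp
      qed
    qed
    show "\<Union> (pairs m B) = B" if "B \<in> {B. B \<subseteq> A \<and> m ` B \<subseteq> B}" for B
      using that by (auto simp: pairs_def)
  qed
  then have "(\<Sum>B | B \<subseteq> A \<and> m ` B \<subseteq> B. f (card B)) = (\<Sum>F\<in>Pow ?E. f (card (\<Union> F)))"
    by (rule sum.reindex_bij_betw[symmetric])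
  also have "\<dots> = (\<Sum>F\<in>Pow ?E. f (2 * card F))"
    by (intro sum.cong) (auto simp: card_Union_pairs[OF m])
  also have "\<dots> = (\<Sum>i\<le>n. \<Sum>F | F \<in> Pow ?E \<and> card F = i. f (2 * card F))"
    using E card_mono[OF E(1)] by (intro sum.group[symmetric]) auto
  also have "\<dots> = (\<Sum>i\<le>n. (n choose i) * f (2 * i))"
    using n_subsets[OF E(1)] E(2) by (intro sum.cong) auto
  finally show ?thesis .
qed

section \<open>A concrete map for every pair of permutations\<close>

definition orbit_label :: "(nat \<Rightarrow> nat) \<Rightarrow> nat \<Rightarrow> nat" where
  "orbit_label \<sigma> x = (LEAST y. \<exists>k. (\<sigma> ^^ k) x = y)"

lemma orbit_label_eq_iff:
  assumes "\<sigma> permutes X" "finite X"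
  shows "orbit_label \<sigma> x = orbit_label \<sigma> y \<longleftrightarrow> (\<exists>k. (\<sigma> ^^ k) x = y)"
proof
  have trans: "\<exists>k. (\<sigma> ^^ k) x = z" if "\<exists>k. (\<sigma> ^^ k) x = y" "\<exists>k. (\<sigma> ^^ k) y = z" for x y z
    using that by (metis comp_apply funpow_add)
  have sym: "\<exists>k. (\<sigma> ^^ k) y = x" if "\<exists>k. (\<sigma> ^^ k) x = y" for x y
    using that permutes_funpow_sym[OF assms] by blast
  have lab: "\<exists>k. (\<sigma> ^^ k) x = orbit_label \<sigma> x" for x
    unfolding orbit_label_def by (rule LeastI_ex) blast
  show "\<exists>k. (\<sigma> ^^ k) x = y" if "orbit_label \<sigma> x = orbit_label \<sigma> y"
    using lab[of x] sym[OF lab[of y]] trans that by metis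
  show "orbit_label \<sigma> x = orbit_label \<sigma> y" if "\<exists>k. (\<sigma> ^^ k) x = y"
  proof -
    have "(\<exists>k. (\<sigma> ^^ k) x = z) \<longleftrightarrow> (\<exists>k. (\<sigma> ^^ k) y = z)" for z
      using trans[of x y z] trans[of y x z] sym[OF that] that by argo
    then show ?thesis by (simp add: orbit_label_def)
  qed
qed

text \<open>The cycles of \<open>\<sigma>\<close> serve as vertices, each named by its least
  element, and half-edges are their own labels. For connected data,
  \<open>isthmic_parts_unique\<close> makes any other represented map equally good for counting
  parts.\<close>

definition rep_map :: "nat set \<Rightarrow> (nat \<Rightarrow> nat) \<Rightarrow> nat \<Rightarrow> (nat \<Rightarrow> nat) \<Rightarrow> (nat, nat) rooted_cmap" where
  "rep_map A m r \<sigma> =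
     \<lparr>verts = orbit_label \<sigma> ` insert r A, half_edges = A, vert_of = orbit_label \<sigma>, mate = m,
      rot = first_return \<sigma> A,
      root_corner = (if \<exists>x\<in>A. orbit_label \<sigma> x = orbit_label \<sigma> r
        then Before (first_return \<sigma> A r) else Bare (orbit_label \<sigma> r))\<rparr>"

lemma represents_rep_map:
  assumes "matching m A" "r \<notin> A" "\<sigma> permutes insert r A"
  shows "represents (rep_map A m r \<sigma>) A {r} m r \<sigma> id (orbit_label \<sigma>)"
proof -
  have "finite (insert r A)" using assms(1) by (auto simp: matching_def)
  then show ?thesis
    using assms orbit_label_eq_iff[OF assms(3)] by (simp add: represents_def rep_map_def)
qed

definition parts :: "nat set \<Rightarrow> (nat \<Rightarrow> nat) \<Rightarrow> nat \<Rightarrow> (nat \<Rightarrow> nat) \<Rightarrow> nat" where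
  "parts A m r \<sigma> = isthmic_parts (rep_map A m r \<sigma>)"

lemma isthmic_parts_represents:
  assumes "\<sigma> \<in> conn_perms A m r" "represents M A {r} m r \<sigma> g w"
  shows "isthmic_parts M = parts A m r \<sigma>"
proof -
  have "represents (rep_map A m r \<sigma>) A {r} m r \<sigma> id (orbit_label \<sigma>)"
    using representsD(2,4)[OF assms(2)] assms(1) by (intro represents_rep_map) (auto simp: conn_perms_def)
  then show ?thesis unfolding parts_def using isthmic_parts_unique[OF assms] by blast
qed

lemma parts_attach:
  assumes "root_edge A m r h" "\<sigma> \<in> conn_perms (A - {h, m h}) m r" "b \<in> insert r (A - {h, m h})"
  shows "parts A m r (attach r h (m h) b \<sigma>) = parts (A - {h, m h}) m r \<sigma>"
proof -
  interpret root_edge A m r h by fact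
  have "represents (rep_map A m r (attach r h h' b \<sigma>)) A {r} m r (attach r h h' b \<sigma>) id
      (orbit_label (attach r h h' b \<sigma>))"
    using attach_conn(1)[OF assms(2,3)] by (intro represents_rep_map matching r_notin) (auto simp: conn_perms_def)
  from isthmic_parts_attach[OF this assms(2,3)] show ?thesis
    using isthmic_parts_represents[OF assms(2)] by (simp add: parts_def)
qed

lemma parts_bridge:
  assumes "root_edge A m r h" and B: "B \<subseteq> A - {h, m h}" "m ` B \<subseteq> B"
    and \<alpha>: "\<alpha> \<in> conn_perms B m r" and \<beta>: "\<beta> \<in> conn_perms (A - {h, m h} - B) m (m h)"
  shows "parts A m r (bridge r h \<alpha> \<beta>) = Suc (parts B m r \<alpha>)"
proof -
  interpret root_edge A m r h by fact
  have "represents (rep_map A m r (bridge r h \<alpha> \<beta>)) A {r} m r (bridge r h \<alpha> \<beta>) id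
      (orbit_label (bridge r h \<alpha> \<beta>))"
    using bridge_conn(1)[OF B \<alpha> \<beta>] by (intro represents_rep_map matching r_notin) (auto simp: conn_perms_def)
  from isthmic_parts_bridge[OF this B \<alpha> \<beta>] show ?thesis
    using isthmic_parts_represents[OF \<alpha>] by (simp add: parts_def)
qed

section \<open>Cardinalities for a fixed matching\<close>

lemma finite_conn_perms: "finite A \<Longrightarrow> finite (conn_perms A m r)"
  unfolding conn_perms_def by (rule finite_subset[OF _ finite_permutations[of "insert r A"]]) auto

lemma card_filter_bij:
  assumes "bij_betw f X Y"
  shows "card {y \<in> Y. Q y} = card {x \<in> X. Q (f x)}"
proof -
  have "bij_betw f {x \<in> X. Q (f x)} {y \<in> Y. Q y}"
    using assms by (auto simp: bij_betw_def inj_on_def)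
  then show ?thesis by (simp add: bij_betw_same_card)
qed

lemma conn_perms_empty: "conn_perms {} m r = {id}"
  by (auto simp: conn_perms_def permutes_sing intro: reach.base)

lemma card_attach_part:
  assumes "root_edge A m r h"
  shows "card {\<sigma> \<in> {\<sigma> \<in> conn_perms A m r. \<sigma> r = h \<and> m h \<in> reach (A - {h, m h}) m (\<sigma> \<circ> transpose r h) r}.
      Q (parts A m r \<sigma>)}
    = (card A - 1) * card {\<sigma> \<in> conn_perms (A - {h, m h}) m r. Q (parts (A - {h, m h}) m r \<sigma>)}"
proof -
  interpret root_edge A m r h by fact
  have "{p \<in> insert r S \<times> conn_perms S m r. Q (parts A m r (case p of (b, \<sigma>) \<Rightarrow> attach r h h' b \<sigma>))}
      = insert r S \<times> {\<sigma> \<in> conn_perms S m r. Q (parts S m r \<sigma>)}"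
    using parts_attach[OF assms] by auto
  moreover have "card (insert r S) = card A - 1"
  proof -
    have "card S = card A - 2" using basics(1-3) h_in by (subst card_Diff_subset) auto
    moreover have "card A \<ge> card {h, h'}" using basics(1,2) h_in by (intro card_mono) auto
    ultimately show ?thesis using basics(1,3) r_notin by auto
  qed
  ultimately show ?thesis
    using card_filter_bij[OF bij_attach, of "\<lambda>\<sigma>. Q (parts A m r \<sigma>)"] by (simp add: card_cartesian_product)
qed

text \<open>\<open>\<beta>\<close> is counted without condition because c follows only the first
  component; the isthmus itself contributes one, hence \<open>Q \<circ> Suc\<close>.\<close>

lemma card_bridge_part:
  assumes "root_edge A m r h"
  shows "card {\<sigma> \<in> {\<sigma> \<in> conn_perms A m r. \<sigma> r = h \<and> m h \<notin> reach (A - {h, m h}) m (\<sigma> \<circ> transpose r h) r}.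
      Q (parts A m r \<sigma>)}
    = (\<Sum>B | B \<subseteq> A - {h, m h} \<and> m ` B \<subseteq> B.
        card {\<sigma> \<in> conn_perms B m r. (Q \<circ> Suc) (parts B m r \<sigma>)} * card (conn_perms (A - {h, m h} - B) m (m h)))"
proof -
  interpret root_edge A m r h by fact
  let ?Bs = "{B. B \<subseteq> S \<and> m ` B \<subseteq> B}"
  have "{p \<in> SIGMA B:?Bs. conn_perms B m r \<times> conn_perms (S - B) m h'.
        Q (parts A m r (case p of (B, \<alpha>, \<beta>) \<Rightarrow> bridge r h \<alpha> \<beta>))}
      = (SIGMA B:?Bs. {\<sigma> \<in> conn_perms B m r. (Q \<circ> Suc) (parts B m r \<sigma>)} \<times> conn_perms (S - B) m h')"
    using parts_bridge[OF assms] by auto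
  moreover have "card \<dots> = (\<Sum>B\<in>?Bs. card ({\<sigma> \<in> conn_perms B m r. (Q \<circ> Suc) (parts B m r \<sigma>)}
      \<times> conn_perms (S - B) m h'))"
  proof (rule card_SigmaI)
    show "finite ?Bs" using basics(1) by (auto intro: finite_subset[OF _ finite_Pow_iff[THEN iffD2]])
    have "finite B" if "B \<in> ?Bs" for B using that basics(1) by (auto intro: finite_subset)
    then show "\<forall>B\<in>?Bs. finite ({\<sigma> \<in> conn_perms B m r. (Q \<circ> Suc) (parts B m r \<sigma>)} \<times> conn_perms (S - B) m h')"
      using basics(1) finite_conn_perms[of "_ :: nat set" m r]
      by (intro ballI finite_cartesian_product finite_conn_perms) (auto intro: rev_finite_subset)
  qed
  ultimately show ?thesis
    using card_filter_bij[OF bij_bridge, of "\<lambda>\<sigma>. Q (parts A m r \<sigma>)"] by (simp add: card_cartesian_product)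
qed

text \<open>2^n n! is the number of permutations of \<open>A\<close> commuting with
  \<open>m\<close>, that is, of the labellings of a rooted map compatible with a given matching. The
  induction varies \<open>r\<close> and \<open>Q\<close>: the second component has root
  \<open>h'\<close> and the predicate that is always true, the first one has
  \<open>Q \<circ> Suc\<close>.\<close>

lemma card_conn_perms:
  assumes "matching m A" "r \<notin> A" "card A = 2 * n"
  shows "card {\<sigma> \<in> conn_perms A m r. Q (parts A m r \<sigma>)} = 2 ^ n * fact n * map_count Q n"
  using assms
proof (induction n arbitrary: A r Q rule: less_induct)
  case (less n)
  have fin: "finite A" using less.prems by (auto simp: matching_def)
  show ?case
  proof (cases n)
    case 0
    then have A: "A = {}" using less.prems fin by simp
    have "represents (rep_map {} m r id) {} {r} m r id id (orbit_label id)"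
      by (rule represents_rep_map) (auto simp: matching_def permutes_id)
    then have "parts A m r id = 0" unfolding parts_def A by (rule isthmic_parts_empty)
    then have "{\<sigma> \<in> conn_perms A m r. Q (parts A m r \<sigma>)} = (if Q 0 then {id} else {})"
      unfolding A conn_perms_empty by auto
    then show ?thesis using 0 by simp
  next
    case (Suc k)
    \<comment> \<open>All 2(k+1) choices of \<open>h\<close> contribute equally, and 2(k+1) times
      2^k k! is the factor for \<open>n = Suc k\<close>.\<close>
    have one: "card {\<sigma> \<in> conn_perms A m r. \<sigma> r = h \<and> Q (parts A m r \<sigma>)} = 2 ^ k * fact k * map_count Q (Suc k)"
      if h: "h \<in> A" for h
    proof -
      interpret root_edge A m r h using h less.prems by unfold_locales auto
      have cS: "card S = 2 * k"
        using less.prems(3) Suc h_in basics(1-3) by (subst card_Diff_subset) auto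
      have rS: "r \<notin> S" "h' \<notin> S" using r_notin by auto
      have bij: "card {\<sigma> \<in> conn_perms B m r. (Q \<circ> Suc) (parts B m r \<sigma>)} * card (conn_perms (S - B) m h')
          = (\<lambda>c. (2 ^ (c div 2) * fact (c div 2) * map_count (Q \<circ> Suc) (c div 2)) *
             (2 ^ (k - c div 2) * fact (k - c div 2) * total_count (k - c div 2))) (card B)"
        if B: "B \<subseteq> S" "m ` B \<subseteq> B" for B
      proof -
        have mB: "matching m B" using matching_S B by (rule matching_subset)
        have mC: "matching m (S - B)"
        proof (rule matching_subset[OF matching_S])
          show "m ` (S - B) \<subseteq> S - B"
          proof
            fix y assume "y \<in> m ` (S - B)"
            then obtain x where x: "x \<in> S" "x \<notin> B" "y = m x" by auto
            then have "m y = x" using matching by (auto simp: matching_def)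
            then show "y \<in> S - B" using x m_S[of x] B by auto
          qed
        qed auto
        obtain i where i: "card B = 2 * i" using card_pairs[OF mB] by auto
        have "finite S" using basics(1) by auto
        then have "card B \<le> card S" "card (S - B) = card S - card B"
          using B by (auto intro: card_mono simp: card_Diff_subset finite_subset)
        then have j: "i \<le> k" "card (S - B) = 2 * (k - i)" using i cS by auto
        have 1: "card {\<sigma> \<in> conn_perms B m r. (Q \<circ> Suc) (parts B m r \<sigma>)} = 2 ^ i * fact i * map_count (Q \<circ> Suc) i"
          using j Suc rS B i by (intro less.IH mB) auto
        have "card {\<sigma> \<in> conn_perms (S - B) m h'. True} = 2 ^ (k - i) * fact (k - i) * total_count (k - i)"
          using j Suc rS B i by (intro less.IH mC) auto
        then show ?thesis using 1 i by simp
      qed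
      have "card {\<sigma> \<in> conn_perms A m r. \<sigma> r = h \<and> Q (parts A m r \<sigma>)}
          = card {\<sigma> \<in> {\<sigma> \<in> conn_perms A m r. \<sigma> r = h \<and> h' \<in> reach S m (\<sigma> \<circ> transpose r h) r}. Q (parts A m r \<sigma>)}
          + card {\<sigma> \<in> {\<sigma> \<in> conn_perms A m r. \<sigma> r = h \<and> h' \<notin> reach S m (\<sigma> \<circ> transpose r h) r}. Q (parts A m r \<sigma>)}"
        using finite_conn_perms[OF fin] by (subst card_Un_disjoint[symmetric]) (auto intro!: arg_cong[of _ _ card])
      also have "\<dots> = (2 * k + 1) * (2 ^ k * fact k * map_count Q k)
          + (\<Sum>B | B \<subseteq> S \<and> m ` B \<subseteq> B.
              card {\<sigma> \<in> conn_perms B m r. (Q \<circ> Suc) (parts B m r \<sigma>)} * card (conn_perms (S - B) m h'))"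
        unfolding card_attach_part[OF root_edge_axioms] card_bridge_part[OF root_edge_axioms]
        using less.IH[of k S r Q] Suc matching_S rS cS less.prems(3) by simp
      also have "(\<Sum>B | B \<subseteq> S \<and> m ` B \<subseteq> B.
              card {\<sigma> \<in> conn_perms B m r. (Q \<circ> Suc) (parts B m r \<sigma>)} * card (conn_perms (S - B) m h'))
          = (\<Sum>i\<le>k. (k choose i) * ((2 ^ i * fact i * map_count (Q \<circ> Suc) i) *
             (2 ^ (k - i) * fact (k - i) * total_count (k - i))))"
        using bij sum_closed_subsets[OF matching_S cS, of "\<lambda>c. (2 ^ (c div 2) * fact (c div 2) * map_count (Q \<circ> Suc) (c div 2)) *
             (2 ^ (k - c div 2) * fact (k - c div 2) * total_count (k - c div 2))"] by simp
      \<comment> \<open>The number of ways to distribute the edges times the factors of both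
        components is 2^k k! for every \<open>i\<close>; what remains is the convolution of
        \<open>map_count\<close>.\<close>
      also have "\<dots> = (\<Sum>i\<le>k. 2 ^ k * fact k * (map_count (Q \<circ> Suc) i * total_count (k - i)))"
      proof (rule sum.cong)
        fix i assume "i \<in> {..k}"
        then have "(k choose i) * fact i * fact (k - i) = fact k" "2 ^ i * 2 ^ (k - i) = (2 ^ k :: nat)"
          using binomial_fact_lemma[of i k] by (auto simp: mult_ac power_add[symmetric])
        moreover have "(k choose i) * ((2 ^ i * fact i * map_count (Q \<circ> Suc) i) * (2 ^ (k - i) * fact (k - i) * total_count (k - i)))
          = (2 ^ i * 2 ^ (k - i)) * ((k choose i) * fact i * fact (k - i)) * (map_count (Q \<circ> Suc) i * total_count (k - i))"
          by (simp add: mult_ac)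
        ultimately show "(k choose i) * ((2 ^ i * fact i * map_count (Q \<circ> Suc) i) * (2 ^ (k - i) * fact (k - i) * total_count (k - i)))
          = 2 ^ k * fact k * (map_count (Q \<circ> Suc) i * total_count (k - i))" by simp
      qed simp
      finally show ?thesis by (simp add: sum_distrib_left algebra_simps)
    qed
    have ne: "\<sigma> r \<in> A" if "\<sigma> \<in> conn_perms A m r" for \<sigma>
      using that conn_perms_fixed_root[OF that] less.prems Suc permutes_in_image[of \<sigma> "insert r A" r]
      by (auto simp: conn_perms_def)
    have "{\<sigma> \<in> conn_perms A m r. Q (parts A m r \<sigma>)} = (\<Union>h\<in>A. {\<sigma> \<in> conn_perms A m r. \<sigma> r = h \<and> Q (parts A m r \<sigma>)})"
      using ne by auto
    also have "card \<dots> = (\<Sum>h\<in>A. card {\<sigma> \<in> conn_perms A m r. \<sigma> r = h \<and> Q (parts A m r \<sigma>)})"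
      using fin finite_conn_perms[OF fin] by (intro card_UN_disjoint) auto
    also have "\<dots> = card A * (2 ^ k * fact k * map_count Q (Suc k))"
      using one by simp
    finally show ?thesis using Suc less.prems(3) by (simp add: algebra_simps del: map_count.simps)
  qed
qed

section \<open>Labellings of isomorphism classes\<close>

lemma represents_iso:
  assumes M: "represents M A P m r \<sigma> g w" and iso: "rooted_iso M N"
  shows "\<exists>g' w'. represents N A P m r \<sigma> g' w'"
proof -
  note R = representsD[OF M]
  obtain f k where f: "bij_betw f (verts M) (verts N)" and k: "bij_betw k (half_edges M) (half_edges N)"
    and hom: "\<And>h. h \<in> half_edges M \<Longrightarrow> vert_of N (k h) = f (vert_of M h) \<and> mate N (k h) = k (mate M h) \<and>
       rot N (k h) = k (rot M h)"
    and root: "root_corner N = map_corner f k (root_corner M)"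
    using iso unfolding rooted_iso_def by blast
  have inj: "f (w x) = f (w y) \<longleftrightarrow> w x = w y" if "x \<in> A \<union> P" "y \<in> A \<union> P" for x y
  proof -
    have "w x \<in> verts M" "w y \<in> verts M" using that R(7) by auto
    then show ?thesis using f by (metis bij_betw_imp_inj_on inj_on_eq_iff)
  qed
  have "represents N A P m r \<sigma> (k \<circ> g) (f \<circ> w)"
    unfolding represents_def
  proof (intro conjI)
    show "inj_on (k \<circ> g) A" using k R(5,8) by (simp add: bij_betw_def comp_inj_on)
    show "verts N = (f \<circ> w) ` (A \<union> P)"
      using bij_betw_imp_surj_on[OF f] unfolding R(7) by (simp add: image_comp)
    show "half_edges N = (k \<circ> g) ` A"
      using bij_betw_imp_surj_on[OF k] unfolding R(8) by (simp add: image_comp)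
    show "\<forall>x\<in>A. vert_of N ((k \<circ> g) x) = (f \<circ> w) x \<and> mate N ((k \<circ> g) x) = (k \<circ> g) (m x) \<and>
        rot N ((k \<circ> g) x) = (k \<circ> g) (first_return \<sigma> A x)"
      using hom R(8,9,10,11) by simp
    show "\<forall>x\<in>A \<union> P. \<forall>y\<in>A \<union> P. ((f \<circ> w) x = (f \<circ> w) y) = (\<exists>k. (\<sigma> ^^ k) x = y)"
    proof (intro ballI)
      fix x y assume "x \<in> A \<union> P" "y \<in> A \<union> P"
      then show "((f \<circ> w) x = (f \<circ> w) y) = (\<exists>k. (\<sigma> ^^ k) x = y)"
        using inj[of x y] R(12)[of x y] by simp
    qed
    have "(\<exists>x\<in>A. f (w x) = f (w r)) \<longleftrightarrow> (\<exists>x\<in>A. w x = w r)"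
      using inj R(3) by (meson UnI1 UnI2)
    then show "root_corner N = (if \<exists>x\<in>A. (f \<circ> w) x = (f \<circ> w) r
        then Before ((k \<circ> g) (first_return \<sigma> A r)) else Bare ((f \<circ> w) r))"
      using root R(13) by simp
  qed (use R(1,2,3,4,6) in auto)
  then show ?thesis by blast
qed

text \<open>\<open>w\<close> and \<open>w'\<close> have the same fibres, namely the orbits of
  \<open>\<sigma>\<close>, so \<open>w'\<close> factors through \<open>w\<close> and gives the
  bijection of vertices; half-edges correspond through their common labels.\<close>

lemma represents_imp_iso:
  assumes M: "represents M A P m r \<sigma> g w" and N: "represents N A P m r \<sigma> g' w'"
  shows "rooted_iso M N"
proof -
  note RM = representsD[OF M] and RN = representsD[OF N]
  define f where "f = w' \<circ> inv_into (A \<union> P) w"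
  define k where "k = g' \<circ> inv_into A g"
  have w_iff: "w x = w y \<longleftrightarrow> w' x = w' y" if "x \<in> A \<union> P" "y \<in> A \<union> P" for x y
    using RM(12)[OF that] RN(12)[OF that] by simp
  have fw: "f (w x) = w' x" if "x \<in> A \<union> P" for x
  proof -
    let ?y = "inv_into (A \<union> P) w (w x)"
    have "w ?y = w x" "?y \<in> A \<union> P" using f_inv_into_f inv_into_into imageI[OF that, of w] by metis+
    then show ?thesis using w_iff[of ?y x] that by (simp add: f_def)
  qed
  have kg: "k (g x) = g' x" if "x \<in> A" for x using that RM(5) by (simp add: k_def)
  have fr: "first_return \<sigma> A x \<in> A" if "x \<in> A" for x
    using permutes_returns[OF RM(6,14) that] by (rule first_return_in)
  have "bij_betw f (verts M) (verts N)"
  proof (rule bij_betw_imageI)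
    show "inj_on f (verts M)" unfolding RM(7) using fw w_iff by (auto simp: inj_on_def)
    show "f ` verts M = verts N" unfolding RM(7) RN(7) image_image using fw by simp
  qed
  moreover have "bij_betw k (half_edges M) (half_edges N)"
  proof (rule bij_betw_imageI)
    show "inj_on k (half_edges M)" unfolding RM(8) using kg RN(5) by (auto simp: inj_on_def)
    show "k ` half_edges M = half_edges N" unfolding RM(8) RN(8) image_image using kg by simp
  qed
  moreover have "vert_of N (k h) = f (vert_of M h) \<and> mate N (k h) = k (mate M h) \<and> rot N (k h) = k (rot M h)"
    if h: "h \<in> half_edges M" for h
  proof -
    obtain x where "x \<in> A" "h = g x" using h RM(8) by auto
    then show ?thesis
      using kg fw fr RM(9,10,11,15) RN(9,10,11) by simp
  qed
  moreover have "root_corner N = map_corner f k (root_corner M)"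
  proof (cases "\<exists>x\<in>A. w x = w r")
    case True
    then have "first_return \<sigma> A r \<in> A" by (intro first_return_in represents_root_returns[OF M])
    moreover have "\<exists>x\<in>A. w' x = w' r" using True w_iff RM(3) by (meson UnI1 UnI2)
    ultimately show ?thesis using RM(13) RN(13) True kg by simp
  next
    case False
    moreover have "\<not> (\<exists>x\<in>A. w' x = w' r)" using False w_iff RM(3) by (meson UnI1 UnI2)
    ultimately show ?thesis using RM(13) RN(13) fw RM(3) by simp
  qed
  ultimately show ?thesis unfolding rooted_iso_def by blast
qed

lemma represents_root_corner:
  assumes M: "represents M A P m r \<sigma> g w" and "\<sigma> r \<in> A"
  shows "root_corner M = Before (g (\<sigma> r))"
proof -
  note R = representsD[OF M]
  have "w (\<sigma> r) = w r" using represents_rot_vertex(2)[OF M, of r] R(3) by simp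
  then have "\<exists>x\<in>A. w x = w r" using assms(2) by blast
  then show ?thesis using R(13) first_return_now[of \<sigma> r A] assms(2) by simp
qed

text \<open>The record shows \<open>\<sigma>\<close> only through its first return to
  \<open>A\<close>. As \<open>r\<close> is the only phantom, what remains is the place of
  \<open>r\<close>, and the root corner gives it: directly before \<open>\<sigma> r\<close>.\<close>

lemma represents_perm_unique:
  assumes M: "represents M A {r} m r \<sigma> g w" and N: "represents M A {r} m' r \<sigma>' g w'"
    and c: "\<sigma> \<in> conn_perms A m r" "\<sigma>' \<in> conn_perms A m' r"
  shows "\<forall>x\<in>A. m x = m' x" "\<sigma> = \<sigma>'"
proof -
  note RM = representsD[OF M] and RN = representsD[OF N]
  show "\<forall>x\<in>A. m x = m' x"
  proof
    fix x assume x: "x \<in> A"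
    have "g (m x) = g (m' x)" using RM(10)[OF x] RN(10)[OF x] by simp
    then show "m x = m' x" using RM(5) RM(15)[OF x] RN(15)[OF x] by (simp add: inj_on_eq_iff)
  qed
  have rA: "r \<notin> A" using RM(2) by auto
  show "\<sigma> = \<sigma>'"
  proof (cases "A = {}")
    case True
    then show ?thesis using c conn_perms_empty by (metis singletonD)
  next
    case False
    have rot_r: "s r \<in> A \<and> root_corner M = Before (g (s r))"
      if s: "represents M A {r} n r s g v" "s \<in> conn_perms A n r" for n s v
    proof -
        have "s r \<in> A" using conn_perms_fixed_root[OF s(2)] False rA represents_rot_vertex(1)[OF s(1), of r] by auto
      then show ?thesis using represents_root_corner[OF s(1)] by simp
    qed
    have r: "\<sigma> r = \<sigma>' r" "\<sigma> r \<in> A" using rot_r[OF M c(1)] rot_r[OF N c(2)] RM(5) by (auto simp: inj_on_eq_iff)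
    \<comment> \<open>An \<open>x\<close> in \<open>A\<close> whose first return is
      \<open>s r\<close> must have passed through \<open>r\<close>, since \<open>s\<close> is
      injective and \<open>r\<close> already precedes \<open>s r\<close>.\<close>
    have s_eq: "s x = (if first_return s A x = s r then r else first_return s A x)"
      if s: "s permutes insert r A" "s r \<in> A" and x: "x \<in> A" for s x
    proof (cases "s x \<in> A")
      case True
      have "s x \<noteq> s r" using x rA s(1) by (metis permutes_inj injD)
      then show ?thesis using True by (simp add: first_return_now)
    next
      case out: False
      then have "s x = r" using permutes_in_image[OF s(1), of x] x by auto
      moreover have "first_return s A x = first_return s A (s x)"
        using out s x RM(18) by (intro first_return_later permutes_returns[OF s(1)]) auto
      ultimately show ?thesis using s(2) by (simp add: first_return_now)
    qed
    have fr: "first_return \<sigma> A x = first_return \<sigma>' A x" if x: "x \<in> A" for x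
    proof -
      have "g (first_return \<sigma> A x) = g (first_return \<sigma>' A x)" using RM(11)[OF x] RN(11)[OF x] by simp
      moreover have "first_return \<sigma> A x \<in> A" "first_return \<sigma>' A x \<in> A"
        using permutes_returns[OF RM(6,14) x] permutes_returns[OF RN(6,14) x] by (auto intro: first_return_in)
      ultimately show ?thesis using RM(5) by (simp add: inj_on_eq_iff)
    qed
    show ?thesis
    proof
      fix x
      have p: "\<sigma> permutes insert r A" "\<sigma>' permutes insert r A" using c by (auto simp: conn_perms_def)
      consider "x = r" | "x \<in> A" | "x \<notin> insert r A" by auto
      then show "\<sigma> x = \<sigma>' x"
      proof cases
        case 2
        then show ?thesis using s_eq[OF p(1) _ 2] s_eq[OF p(2) _ 2] r fr[OF 2] by simp
      next
        case 3
        then show ?thesis using p by (metis permutes_not_in)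
      qed (use r in simp)
    qed
  qed
qed

text \<open>Rigidity: a rooted map has no nontrivial automorphism.\<close>

lemma represents_labelling_unique:
  assumes M: "represents M A {r} m r \<sigma> g w" and N: "represents M A {r} m r \<sigma> g' w'"
    and c: "\<sigma> \<in> conn_perms A m r" and x: "x \<in> A"
  shows "g x = g' x"
proof -
  note RM = representsD[OF M] and RN = representsD[OF N]
  \<comment> \<open>The root corner fixes the first label; \<open>rot\<close> and
    \<open>mate\<close> of \<open>M\<close> then carry the agreement to everything
    reachable.\<close>
  have "x \<in> insert r A \<and> (x \<in> A \<longrightarrow> g x = g' x)" if "x \<in> reach A m \<sigma> r" for x
    using that
  proof induction
    case base
    then show ?case using RM(2) by auto
  next
    case (rot x)
    have s: "\<sigma> x \<in> insert r A" using rot represents_rot_vertex(1)[OF M, of x] by auto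
    moreover have "g (\<sigma> x) = g' (\<sigma> x)" if sx: "\<sigma> x \<in> A"
    proof (cases "x = r")
      case True
      have "Before (g (\<sigma> r)) = Before (g' (\<sigma> r))"
        using represents_root_corner[OF M] represents_root_corner[OF N] sx True by simp
      then show ?thesis using True by simp
    next
      case False
      then have "x \<in> A" "g x = g' x" using rot by auto
      then show ?thesis using RM(11)[of x] RN(11)[of x] first_return_now[of \<sigma> x A] sx by simp
    qed
    ultimately show ?case by simp
  next
    case (mate x)
    then show ?case using RM(10)[of x] RN(10)[of x] RM(15)[of x] by simp
  qed
  then show ?thesis using x c by (auto simp: conn_perms_def)
qed

section \<open>Every rooted map is represented, for any labelling of its half-edges\<close>

lemma connected_reachable:
  assumes "card (conn_components M) = 1" "u \<in> verts M" "v \<in> verts M"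
  shows "(v, u) \<in> (adj M)\<^sup>*"
proof -
  let ?E = "(adj M)\<^sup>* \<inter> verts M \<times> verts M"
  obtain C where C: "conn_components M = {C}" using assms(1) by (auto simp: card_1_singleton_iff)
  have "?E `` {u} \<in> conn_components M" "?E `` {v} \<in> conn_components M"
    unfolding conn_components_def using assms(2,3) by (auto intro: quotientI)
  then have "?E `` {u} = ?E `` {v}" unfolding C by simp
  moreover have "u \<in> ?E `` {u}" using assms(2) by auto
  ultimately show ?thesis by auto
qed

lemma bare_root_no_half_edges:
  assumes M: "is_rooted_cmap M" and root: "root_corner M = Bare v"
  shows "half_edges M = {}" "verts M = {v}"
proof -
  have cm: "is_cmap M" and v: "v \<in> verts M" "v \<notin> vert_of M ` half_edges M"
    using M root by (auto simp: is_rooted_cmap_def corners_def)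
  have "u = v" if u: "u \<in> verts M" for u
  proof -
    have "(v, u) \<in> (adj M)\<^sup>*" using cm u v(1) by (intro connected_reachable) (auto simp: is_cmap_def)
    then show ?thesis
    proof (cases rule: converse_rtranclE)
      case (step y)
      then show ?thesis using v(2) by (auto simp: adj_def)
    qed simp
  qed
  then show verts: "verts M = {v}" using v(1) by blast
  have "vert_of M h = v" if "h \<in> half_edges M" for h
    using cm that verts unfolding is_cmap_def by blast
  then show "half_edges M = {}" using v(2) by blast
qed

lemma represents_exists:
  assumes M: "is_rooted_cmap M" and g: "bij_betw g A (half_edges M)" and r: "r \<notin> A"
  shows "\<exists>m \<sigma> w. (\<forall>x. x \<notin> A \<longrightarrow> m x = x) \<and> \<sigma> \<in> conn_perms A m r \<and> represents M A {r} m r \<sigma> g w"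
proof -
  have cm: "is_cmap M" and root: "root_corner M \<in> corners M"
    using M by (auto simp: is_rooted_cmap_def)
  have H: "finite (half_edges M)" "bij_betw (rot M) (half_edges M) (half_edges M)"
    "\<And>h. h \<in> half_edges M \<Longrightarrow> vert_of M h \<in> verts M"
    "\<And>h. h \<in> half_edges M \<Longrightarrow> mate M h \<in> half_edges M \<and> mate M h \<noteq> h \<and> mate M (mate M h) = h"
    "\<And>h h'. h \<in> half_edges M \<Longrightarrow> h' \<in> half_edges M \<Longrightarrow>
      vert_of M h = vert_of M h' \<longleftrightarrow> (\<exists>k. (rot M ^^ k) h = h')"
    "card (conn_components M) = 1"
    using cm by (auto simp: is_cmap_def)
  have A: "finite A" using g H(1) bij_betw_finite by blast
  define g' where "g' = inv_into A g"
  have gg: "g' (g x) = x" "g x \<in> half_edges M" if "x \<in> A" for x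
    using that g unfolding g'_def by (auto simp: bij_betw_def)
  have gg': "g (g' h) = h" "g' h \<in> A" if "h \<in> half_edges M" for h
    using that g unfolding g'_def by (auto simp: bij_betw_def f_inv_into_f inv_into_into)
  have H_eq: "half_edges M = g ` A" and inj: "inj_on g A" using g by (auto simp: bij_betw_def)
  \<comment> \<open>The identity off \<open>A\<close> is the normal form demanded by
    \<open>involutions\<close>, where each matching is to be one function.\<close>
  define m where "m x = (if x \<in> A then g' (mate M (g x)) else x)" for x
  define p where "p x = (if x \<in> A then g' (rot M (g x)) else x)" for x
  have m: "matching m A" unfolding matching_def
  proof (intro conjI ballI A)
    fix x assume x: "x \<in> A"
    have *: "mate M (g x) \<in> half_edges M" "mate M (g x) \<noteq> g x" "mate M (mate M (g x)) = g x"
      using H(4)[OF gg(2)[OF x]] by auto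
    show "m x \<in> A" using x * gg' by (simp add: m_def)
    show "m x \<noteq> x" using x * gg'[OF *(1)] by (auto simp: m_def)
    show "m (m x) = x" using x * gg' gg by (simp add: m_def)
  qed
  have gm: "mate M (g x) = g (m x)" if "x \<in> A" for x
    using that H(4) gg gg' by (simp add: m_def)
  have rotH: "rot M h \<in> half_edges M" if "h \<in> half_edges M" for h
    using that H(2) by (auto simp: bij_betw_def)
  have gp: "p x \<in> A \<and> rot M (g x) = g (p x)" if "x \<in> A" for x
    using that rotH gg gg' by (simp add: p_def)
  have p: "p permutes A"
  proof (rule bij_imp_permutes)
    have "bij_betw (g' \<circ> rot M \<circ> g) A A"
      using g H(2) bij_betw_inv_into[OF g] unfolding g'_def by (intro bij_betw_trans)
    then show "bij_betw p A A"
      by (rule bij_betw_cong[THEN iffD1, rotated]) (simp add: p_def)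
  qed (simp add: p_def)
  have m_off: "\<forall>x. x \<notin> A \<longrightarrow> m x = x" by (simp add: m_def)
  have conn: "\<sigma> \<in> conn_perms A m r" if "represents M A {r} m r \<sigma> g w" for \<sigma> w
    using card_conn_components_disconnected[OF that] H(6) representsD(6)[OF that]
    unfolding conn_perms_def by fastforce
  show ?thesis
  proof (cases "root_corner M")
    case (Bare v)
    note E = bare_root_no_half_edges[OF M Bare]
    then have "A = {}" using H_eq by auto
    then have "represents M A {r} m r id g (\<lambda>_. v)"
      using E Bare m by (simp add: represents_def permutes_id)
    then show ?thesis using m_off conn by blast
  next
    case (Before h0)
    then have h0: "h0 \<in> half_edges M" using root by (auto simp: corners_def)
    define b where "b = g' h0"
    have b: "b \<in> A" "g b = h0" using gg' h0 by (auto simp: b_def)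
    \<comment> \<open>\<open>r\<close> is put before \<open>b\<close>, the half-edge following the
      root corner; skipping \<open>r\<close> gives back \<open>p\<close>.\<close>
    define \<sigma> where "\<sigma> = transpose r b \<circ> p"
    define w where "w x = (if x \<in> A then vert_of M (g x) else vert_of M h0)" for x
    have fr: "first_return \<sigma> A x = p x" if "x \<in> A" for x
      unfolding \<sigma>_def using p r b(1) that by (rule first_return_insert)
    have pr: "p r = r" using r by (simp add: p_def)
    have \<sigma>r: "\<sigma> r = b" by (simp add: \<sigma>_def pr)
    have perm: "\<sigma> permutes insert r A"
      unfolding \<sigma>_def using b(1) by (intro permutes_compose[OF permutes_subset[OF p]] permutes_swap_id) auto
    have wb: "w b = w r" using b r by (simp add: w_def)
    have AA: "w x = w y \<longleftrightarrow> (\<exists>k. (\<sigma> ^^ k) x = y)" if xy: "x \<in> A" "y \<in> A" for x y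
    proof -
      have pk: "(p ^^ k) x \<in> A \<and> (rot M ^^ k) (g x) = g ((p ^^ k) x)" for k
        using funpow_transfer[of A p "rot M" g x k] gp xy(1) by blast
      have fk: "(first_return \<sigma> A ^^ k) x = (p ^^ k) x" for k
        using funpow_transfer[of A p "first_return \<sigma> A" "\<lambda>x. x" x k] gp fr xy(1) by simp
      have "w x = w y \<longleftrightarrow> (\<exists>k. (rot M ^^ k) (g x) = g y)"
        using H(5)[OF gg(2) gg(2)] xy by (simp add: w_def)
      also have "\<dots> \<longleftrightarrow> (\<exists>k. (first_return \<sigma> A ^^ k) x = y)"
        using pk fk inj xy(2) by (simp add: inj_on_eq_iff)
      also have "\<dots> \<longleftrightarrow> (\<exists>k. (\<sigma> ^^ k) x = y)" using xy by (rule first_return_funpow_iff)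
      finally show ?thesis .
    qed
    have fin: "finite (insert r A)" using A by simp
    have rA: "w r = w y \<longleftrightarrow> (\<exists>k. (\<sigma> ^^ k) r = y)" if y: "y \<in> A" for y
    proof -
      have "(\<exists>k. (\<sigma> ^^ k) r = y) \<longleftrightarrow> (\<exists>k. (\<sigma> ^^ k) b = y)"
      proof
        assume "\<exists>k. (\<sigma> ^^ k) r = y"
        then obtain k where k: "(\<sigma> ^^ k) r = y" by auto
        then obtain j where "k = Suc j" using y r by (cases k) auto
        then show "\<exists>k. (\<sigma> ^^ k) b = y" using k \<sigma>r by (auto simp: funpow_swap1)
      next
        assume "\<exists>k. (\<sigma> ^^ k) b = y"
        then obtain k where "(\<sigma> ^^ Suc k) r = y" using \<sigma>r by (auto simp: funpow_swap1)
        then show "\<exists>k. (\<sigma> ^^ k) r = y" by blast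
      qed
      then show ?thesis using AA[OF b(1) y] wb by simp
    qed
    have all: "w x = w y \<longleftrightarrow> (\<exists>k. (\<sigma> ^^ k) x = y)" if xy: "x \<in> insert r A" "y \<in> insert r A" for x y
    proof -
      consider "x \<in> A" "y \<in> A" | "x = r" "y \<in> A" | "x \<in> A" "y = r" | "x = r" "y = r" using xy by auto
      then show ?thesis
      proof cases
        case 3
        have "w x = w r \<longleftrightarrow> (\<exists>k. (\<sigma> ^^ k) r = x)" using rA[OF 3(1)] by auto
        also have "\<dots> \<longleftrightarrow> (\<exists>k. (\<sigma> ^^ k) x = r)" using permutes_funpow_sym[OF perm fin] by blast
        finally show ?thesis using 3 by simp
      next
        case 4
        then show ?thesis by (auto intro: exI[of _ 0])
      qed (use AA rA in auto)
    qed
    \<comment> \<open>No vertex is bare: by connectedness it is either the root vertex or an end of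
      some edge.\<close>
    have "verts M = w ` insert r A"
    proof
      have "w x \<in> verts M" if "x \<in> insert r A" for x
        using H(3) gg(2) h0 by (simp add: w_def)
      then show "w ` insert r A \<subseteq> verts M" by blast
      show "verts M \<subseteq> w ` insert r A"
      proof
        fix u assume u: "u \<in> verts M"
        have v: "vert_of M h0 \<in> verts M" using H(3) h0 by blast
        have "(vert_of M h0, u) \<in> (adj M)\<^sup>*" using connected_reachable[OF H(6) u v] .
        then have "u \<in> vert_of M ` half_edges M"
        proof (cases rule: rtranclE)
          case base
          then show ?thesis using h0 by auto
        next
          case (step y)
          then show ?thesis using H(4) by (auto simp: adj_def)
        qed
        then obtain x where "x \<in> A" "u = vert_of M (g x)" using H_eq by auto
        then show "u \<in> w ` insert r A" by (auto simp: w_def)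
      qed
    qed
    moreover have "\<exists>x\<in>A. w x = w r" using wb b by blast
    moreover have "first_return \<sigma> A r = b" using \<sigma>r b by (simp add: first_return_now)
    ultimately have "represents M A {r} m r \<sigma> g w"
      using m r perm all inj H_eq gm gp fr Before b(2) by (auto simp: represents_def w_def)
    then show ?thesis using m_off conn by blast
  qed
qed

lemma represents_labelling_cong:
  assumes M: "represents M A P m r \<sigma> g w" and eq: "\<And>x. x \<in> A \<Longrightarrow> g' x = g x"
  shows "represents M A P m r \<sigma> g' w"
proof -
  note R = representsD[OF M]
  have "first_return \<sigma> A x \<in> A" if "x \<in> A" for x
    using permutes_returns[OF R(6,14) that] by (rule first_return_in)
  moreover have "first_return \<sigma> A r \<in> A" if "\<exists>x\<in>A. w x = w r"
    using represents_root_returns[OF M that] by (rule first_return_in)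
  moreover have "inj_on g' A" "g' ` A = g ` A" using R(5) eq by (auto simp: inj_on_def)
  ultimately show ?thesis
    unfolding represents_def using R eq by simp
qed

section \<open>Isomorphism classes as images of labelled maps\<close>

definition involutions :: "nat set \<Rightarrow> (nat \<Rightarrow> nat) set" where
  "involutions A = {m. matching m A \<and> (\<forall>x. x \<notin> A \<longrightarrow> m x = x)}"

definition labelled :: "nat set \<Rightarrow> nat \<Rightarrow> ((nat \<Rightarrow> nat) \<times> (nat \<Rightarrow> nat)) set" where
  "labelled A r = (SIGMA m:involutions A. conn_perms A m r)"

definition map_class :: "nat set \<Rightarrow> nat \<Rightarrow> (nat \<Rightarrow> nat) \<times> (nat \<Rightarrow> nat) \<Rightarrow> (nat, nat) rooted_cmap set" where
  "map_class A r p = {M. \<exists>g w. represents M A {r} (fst p) r (snd p) g w}"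

lemma labelledD:
  assumes "p \<in> labelled A r"
  shows "fst p \<in> involutions A" "matching (fst p) A" "snd p \<in> conn_perms A (fst p) r"
    "snd p permutes insert r A"
  using assms by (auto simp: labelled_def involutions_def conn_perms_def)

lemma rooted_class_eq:
  assumes M: "represents M A {r} (fst p) r (snd p) g w" and p: "p \<in> labelled A r"
  shows "rooted_iso_rel `` {M} = map_class A r p"
proof -
  have conn: "insert r A \<subseteq> reach A (fst p) (snd p) r"
    using labelledD(3)[OF p] by (simp add: conn_perms_def)
  have "(M, N) \<in> rooted_iso_rel \<longleftrightarrow> N \<in> map_class A r p" for N
  proof
    assume "(M, N) \<in> rooted_iso_rel"
    then show "N \<in> map_class A r p"
      using represents_iso[OF M] by (simp add: rooted_iso_rel_def map_class_def)
  next
    assume "N \<in> map_class A r p"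
    then obtain g' w' where N: "represents N A {r} (fst p) r (snd p) g' w'" by (auto simp: map_class_def)
    then show "(M, N) \<in> rooted_iso_rel"
      using represents_imp_iso[OF M N] represents_is_rooted_cmap[OF M conn] represents_is_rooted_cmap[OF N conn]
      by (simp add: rooted_iso_rel_def)
  qed
  then show ?thesis by blast
qed

lemma represents_rep_map_labelled:
  assumes "p \<in> labelled A r" "r \<notin> A"
  shows "represents (rep_map A (fst p) r (snd p)) A {r} (fst p) r (snd p) id (orbit_label (snd p))"
  using labelledD[OF assms(1)] assms(2) by (intro represents_rep_map)

lemma represents_exists_labelled:
  assumes "is_rooted_cmap M" "bij_betw g A (half_edges M)" "r \<notin> A"
  shows "\<exists>p\<in>labelled A r. \<exists>w. represents M A {r} (fst p) r (snd p) g w"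
proof -
  obtain m \<sigma> w where *: "\<forall>x. x \<notin> A \<longrightarrow> m x = x" "\<sigma> \<in> conn_perms A m r" "represents M A {r} m r \<sigma> g w"
    using represents_exists[OF assms] by blast
  then have "(m, \<sigma>) \<in> labelled A r"
    using representsD(4)[OF *(3)] by (simp add: labelled_def involutions_def)
  then show ?thesis using *(3) by force
qed

lemma rooted_maps_eq: "rooted_maps n = map_class {..<2 * n} (2 * n) ` labelled {..<2 * n} (2 * n)"
proof (intro equalityI subsetI)
  let ?A = "{..<2 * n}" and ?r = "2 * n"
  fix X assume "X \<in> rooted_maps n"
  then obtain M where M: "is_rooted_cmap M" "card (edges M) = n" "X = rooted_iso_rel `` {M}"
    by (auto simp: rooted_maps_def quotient_def)
  have "finite (half_edges M)" using M(1) by (simp add: is_rooted_cmap_def is_cmap_def)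
  then obtain g where "bij_betw g {0..<card (half_edges M)} (half_edges M)"
    using ex_bij_betw_nat_finite by blast
  then have g: "bij_betw g {..<card (half_edges M)} (half_edges M)" by (simp add: atLeast0LessThan)
  \<comment> \<open>This first representation serves to find that there are 2n half-edges; the next
    one then has the label set required.\<close>
  obtain p w where "represents M {..<card (half_edges M)} {card (half_edges M)} (fst p)
      (card (half_edges M)) (snd p) g w"
    using represents_exists_labelled[OF M(1) g, of "card (half_edges M)"] by auto
  from represents_card_edges[OF this] have card: "card (half_edges M) = 2 * n" using M(2) by simp
  then obtain p w where p: "p \<in> labelled ?A ?r" "represents M ?A {?r} (fst p) ?r (snd p) g w"
    using represents_exists_labelled[OF M(1) g, of "card (half_edges M)"] by auto
  then show "X \<in> map_class ?A ?r ` labelled ?A ?r"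
    using rooted_class_eq[OF p(2,1)] M(3) by blast
next
  let ?A = "{..<2 * n}" and ?r = "2 * n"
  fix X assume "X \<in> map_class ?A ?r ` labelled ?A ?r"
  then obtain p where p: "p \<in> labelled ?A ?r" "X = map_class ?A ?r p" by auto
  let ?M = "rep_map ?A (fst p) ?r (snd p)"
  note M = represents_rep_map_labelled[OF p(1)]
  have M: "represents ?M ?A {?r} (fst p) ?r (snd p) id (orbit_label (snd p))"
    using M by simp
  have "is_rooted_cmap ?M"
    using represents_is_rooted_cmap[OF M] labelledD(3)[OF p(1)] by (simp add: conn_perms_def)
  moreover have "card (edges ?M) = n" using represents_card_edges[OF M] by simp
  ultimately show "X \<in> rooted_maps n"
    unfolding rooted_maps_def p(2) rooted_class_eq[OF M p(1), symmetric] by (intro quotientI) simp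
qed

lemma class_isthmic_parts_eq:
  assumes "p \<in> labelled A r" "r \<notin> A"
  shows "class_isthmic_parts (map_class A r p) = parts A (fst p) r (snd p)"
proof -
  have "isthmic_parts M = parts A (fst p) r (snd p)" if "M \<in> map_class A r p" for M
    using that isthmic_parts_represents[OF labelledD(3)[OF assms(1)]] by (auto simp: map_class_def)
  moreover have "rep_map A (fst p) r (snd p) \<in> map_class A r p"
    using represents_rep_map_labelled[OF assms] by (auto simp: map_class_def)
  ultimately have "isthmic_parts ` map_class A r p = {parts A (fst p) r (snd p)}" by force
  then show ?thesis by (simp add: class_isthmic_parts_def)
qed

text \<open>Fix one map \<open>N\<close> of the class with half-edges \<open>A\<close>. Each
  permutation of \<open>A\<close>, read as a labelling of \<open>N\<close>, yields a labelled map.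
  Rigidity makes this injective, and every labelled map of the class arises because it represents
  \<open>N\<close> through some labelling.\<close>

lemma card_map_class_fibre:
  assumes q: "q \<in> labelled A r" and r: "r \<notin> A"
  shows "card {p \<in> labelled A r. map_class A r p = map_class A r q} = fact (card A)"
proof -
  define N where "N = rep_map A (fst q) r (snd q)"
  have Nq: "represents N A {r} (fst q) r (snd q) id (orbit_label (snd q))"
    unfolding N_def using represents_rep_map_labelled[OF q r] .
  have N: "is_rooted_cmap N" "half_edges N = A"
    using represents_is_rooted_cmap[OF Nq] labelledD(3)[OF q] representsD(8)[OF Nq]
    by (auto simp: conn_perms_def)
  have A: "finite A" using labelledD(2)[OF q] by (simp add: matching_def)
  let ?rep = "\<lambda>p \<pi>. \<exists>w. represents N A {r} (fst p) r (snd p) \<pi> w"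
  let ?F = "{p \<in> labelled A r. map_class A r p = map_class A r q}"
  have F: "?F = {p \<in> labelled A r. \<exists>g. ?rep p g}"
  proof -
    have "map_class A r p = map_class A r q \<longleftrightarrow> (\<exists>g. ?rep p g)" if p: "p \<in> labelled A r" for p
    proof
      assume "map_class A r p = map_class A r q"
      moreover have "N \<in> map_class A r q" using Nq by (auto simp: map_class_def)
      ultimately have "N \<in> map_class A r p" by simp
      then show "\<exists>g. ?rep p g" by (simp add: map_class_def)
    next
      assume "\<exists>g. ?rep p g"
      then show "map_class A r p = map_class A r q"
        using rooted_class_eq[OF _ p] rooted_class_eq[OF Nq q] by metis
    qed
    then show ?thesis by blast
  qed
  define \<psi> where "\<psi> \<pi> = (SOME p. p \<in> labelled A r \<and> ?rep p \<pi>)" for \<pi>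
  have \<psi>: "\<psi> \<pi> \<in> labelled A r \<and> ?rep (\<psi> \<pi>) \<pi>" if "\<pi> permutes A" for \<pi>
  proof -
    have "\<exists>p. p \<in> labelled A r \<and> ?rep p \<pi>"
      using represents_exists_labelled[OF N(1) _ r, of \<pi>] permutes_imp_bij[OF that] N(2) by blast
    then show ?thesis unfolding \<psi>_def by (rule someI_ex)
  qed
  have "bij_betw \<psi> {\<pi>. \<pi> permutes A} ?F"
  proof (rule bij_betw_imageI)
    show "inj_on \<psi> {\<pi>. \<pi> permutes A}"
    proof (rule inj_onI)
      fix \<pi> \<rho> assume "\<pi> \<in> {\<pi>. \<pi> permutes A}" "\<rho> \<in> {\<pi>. \<pi> permutes A}" and eq: "\<psi> \<pi> = \<psi> \<rho>"
      then have perm: "\<pi> permutes A" "\<rho> permutes A" by auto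
      obtain w w' where rep: "represents N A {r} (fst (\<psi> \<pi>)) r (snd (\<psi> \<pi>)) \<pi> w"
          "represents N A {r} (fst (\<psi> \<pi>)) r (snd (\<psi> \<pi>)) \<rho> w'"
        using \<psi>[OF perm(1)] \<psi>[OF perm(2)] eq by auto
      then have "\<pi> x = \<rho> x" if "x \<in> A" for x
        using represents_labelling_unique[OF rep labelledD(3) that] \<psi>[OF perm(1)] by blast
      moreover have "\<pi> x = \<rho> x" if "x \<notin> A" for x
        using permutes_not_in[OF perm(1) that] permutes_not_in[OF perm(2) that] by simp
      ultimately show "\<pi> = \<rho>" by (intro ext) blast
    qed
    show "\<psi> ` {\<pi>. \<pi> permutes A} = ?F"
    proof
      show "\<psi> ` {\<pi>. \<pi> permutes A} \<subseteq> ?F" unfolding F using \<psi> by blast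
      show "?F \<subseteq> \<psi> ` {\<pi>. \<pi> permutes A}"
      proof
        fix p assume "p \<in> ?F"
        then obtain g w where p: "p \<in> labelled A r" and g: "represents N A {r} (fst p) r (snd p) g w"
          unfolding F by blast
        define \<pi> where "\<pi> x = (if x \<in> A then g x else x)" for x
        have "bij_betw g A A" using representsD(5,8)[OF g] N(2) by (simp add: bij_betw_def)
        then have "bij_betw \<pi> A A"
          by (rule bij_betw_cong[THEN iffD1, rotated]) (simp add: \<pi>_def)
        then have \<pi>: "\<pi> permutes A" by (rule bij_imp_permutes) (simp add: \<pi>_def)
        have rep: "represents N A {r} (fst p) r (snd p) \<pi> w"
          using g by (rule represents_labelling_cong) (simp add: \<pi>_def)
        obtain w' where rep': "represents N A {r} (fst (\<psi> \<pi>)) r (snd (\<psi> \<pi>)) \<pi> w'" and l: "\<psi> \<pi> \<in> labelled A r"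
          using \<psi>[OF \<pi>] by blast
        note U = represents_perm_unique[OF rep rep' labelledD(3)[OF p] labelledD(3)[OF l]]
        have "fst p x = fst (\<psi> \<pi>) x" for x
          using U(1) labelledD(1)[OF p] labelledD(1)[OF l] by (cases "x \<in> A") (auto simp: involutions_def)
        then have "p = \<psi> \<pi>" using U(2) by (simp add: prod_eq_iff fun_eq_iff)
        then show "p \<in> \<psi> ` {\<pi>. \<pi> permutes A}" using \<pi> by blast
      qed
    qed
  qed
  then have "card ?F = card {\<pi>. \<pi> permutes A}" by (simp add: bij_betw_same_card)
  then show ?thesis using card_permutations[OF refl A] by simp
qed

lemma finite_involutions: "finite A \<Longrightarrow> finite (involutions A)"
proof (rule finite_subset[OF _ finite_permutations])
  assume "finite A"
  show "involutions A \<subseteq> {m. m permutes A}"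
  proof
    fix m assume m: "m \<in> involutions A"
    have "bij_betw m A A"
      by (rule bij_betwI[where g = m]) (use m in \<open>auto simp: involutions_def matching_def\<close>)
    then show "m \<in> {m. m permutes A}"
      using m by (auto simp: involutions_def intro: bij_imp_permutes)
  qed
qed

lemma involutions_nonempty: "involutions {..<2 * n} \<noteq> {}"
proof -
  define m where "m x = (if x < 2 * n then if even x then x + 1 else x - 1 else x)" for x :: nat
  have "m x < 2 * n \<and> m x \<noteq> x \<and> m (m x) = x" if "x < 2 * n" for x
  proof (cases "even x")
    case True
    then have "x + 1 < 2 * n" using that by (auto elim!: evenE)
    then show ?thesis using True that by (simp add: m_def)
  next
    case False
    then have "x > 0" by (cases x) auto
    then show ?thesis using False that by (auto simp: m_def)
  qed
  then have "m \<in> involutions {..<2 * n}"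
    by (auto simp: involutions_def matching_def m_def)
  then show ?thesis by auto
qed

lemma finite_labelled: "finite A \<Longrightarrow> finite (labelled A r)"
  unfolding labelled_def by (intro finite_SigmaI finite_involutions finite_conn_perms)

text \<open>Double counting of labelled maps: by classes, with (2n)! labellings each, and by
  matchings, with \<open>card_conn_perms\<close> for each.\<close>

lemma card_rooted_maps:
  "card {X \<in> rooted_maps n. Q (class_isthmic_parts X)} * fact (2 * n)
     = card (involutions {..<2 * n}) * (2 ^ n * fact n * map_count Q n)"
proof -
  let ?A = "{..<2 * n}" and ?r = "2 * n"
  let ?L = "labelled ?A ?r" and ?c = "map_class ?A ?r"
  have r: "?r \<notin> ?A" by simp
  let ?T = "{X \<in> rooted_maps n. Q (class_isthmic_parts X)}"
  let ?P = "{p \<in> ?L. Q (parts ?A (fst p) ?r (snd p))}"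
  have fin: "finite ?L" by (simp add: finite_labelled)
  have "?P = {p \<in> ?L. Q (class_isthmic_parts (?c p))}"
    using class_isthmic_parts_eq[OF _ r] by auto
  also have "\<dots> = (\<Union>X\<in>?T. {p \<in> ?L. ?c p = X})"
    unfolding rooted_maps_eq by auto
  finally have "card ?P = (\<Sum>X\<in>?T. card {p \<in> ?L. ?c p = X})"
    using fin by (simp only:) (intro card_UN_disjoint, auto simp: rooted_maps_eq)
  also have "\<dots> = (\<Sum>X\<in>?T. fact (2 * n))"
    using card_map_class_fibre[OF _ r] by (intro sum.cong) (auto simp: rooted_maps_eq)
  finally have *: "card ?P = card ?T * fact (2 * n)" by simp
  have P_eq: "?P = (SIGMA m:involutions ?A. {\<sigma> \<in> conn_perms ?A m ?r. Q (parts ?A m ?r \<sigma>)})"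
    by (auto simp: labelled_def)
  have "card ?P = (\<Sum>m\<in>involutions ?A. card {\<sigma> \<in> conn_perms ?A m ?r. Q (parts ?A m ?r \<sigma>)})"
    unfolding P_eq using finite_conn_perms[of ?A] by (intro card_SigmaI finite_involutions) auto
  also have "\<dots> = (\<Sum>m\<in>involutions ?A. 2 ^ n * fact n * map_count Q n)"
  proof (rule sum.cong)
    fix m assume "m \<in> involutions ?A"
    then have "matching m ?A" by (simp add: involutions_def)
    then show "card {\<sigma> \<in> conn_perms ?A m ?r. Q (parts ?A m ?r \<sigma>)} = 2 ^ n * fact n * map_count Q n"
      using card_conn_perms[of m ?A ?r n Q] by simp
  qed simp
  finally show ?thesis using * by simp
qed

section \<open>Probabilities and convergence in distribution\<close>

lemma finite_rooted_maps: "finite (rooted_maps n)"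
  unfolding rooted_maps_eq by (intro finite_imageI finite_labelled) simp

lemma card_involutions_pos: "card (involutions {..<2 * n}) > 0"
  using involutions_nonempty finite_involutions[of "{..<2 * n}"] by (simp add: card_gt_0_iff)

lemma rooted_maps_nonempty: "rooted_maps n \<noteq> {}"
proof
  assume "rooted_maps n = {}"
  then show False
    using card_rooted_maps[of n "\<lambda>_. True"] card_involutions_pos[of n] total_count_pos[of n] by simp
qed

lemma prob_isthmic_parts:
  "measure_pmf.prob (random_rooted_map n) {X. Q (class_isthmic_parts X)}
     = real (map_count Q n) / real (total_count n)"
proof -
  \<comment> \<open>The factors relating the number of classes to \<open>map_count\<close> do not
    depend on \<open>Q\<close>, so they cancel in the quotient.\<close>
  let ?k = "card (involutions {..<2 * n}) * (2 ^ n * fact n)"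
  have k: "?k > 0" using card_involutions_pos by simp
  have card: "real (card {X \<in> rooted_maps n. Q (class_isthmic_parts X)}) * fact (2 * n)
      = real ?k * real (map_count Q n)" for Q
  proof -
    have "card {X \<in> rooted_maps n. Q (class_isthmic_parts X)} * fact (2 * n) = ?k * map_count Q n"
      using card_rooted_maps[of n Q] by (simp only: mult.assoc)
    then have "real (card {X \<in> rooted_maps n. Q (class_isthmic_parts X)} * fact (2 * n)) = real (?k * map_count Q n)"
      by (rule arg_cong)
    then show ?thesis by (simp only: of_nat_mult of_nat_fact)
  qed
  have "measure_pmf.prob (random_rooted_map n) {X. Q (class_isthmic_parts X)}
      = real (card (rooted_maps n \<inter> {X. Q (class_isthmic_parts X)})) / real (card (rooted_maps n))"
    unfolding random_rooted_map_def
    by (rule measure_pmf_of_set[OF rooted_maps_nonempty finite_rooted_maps])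
  also have "\<dots> = (real (card {X \<in> rooted_maps n. Q (class_isthmic_parts X)}) * fact (2 * n))
      / (real (card {X \<in> rooted_maps n. True}) * fact (2 * n))"
    by (simp add: Int_def)
  also have "\<dots> = real (map_count Q n) / real (total_count n)"
    unfolding card[of Q] card[of "\<lambda>_. True"] using k by (subst mult_divide_mult_cancel_left) auto
  finally show ?thesis .
qed

text \<open>\<open>geometric_pmf\<close> counts failures and starts at 0; the shift by
  \<open>Suc\<close> moves its support to k \<ge> 1.\<close>

lemma pmf_shifted_geometric:
  "pmf (map_pmf Suc (geometric_pmf (1 / 2))) k = (if k = 0 then 0 else (1 / 2) ^ k)"
proof (cases k)
  case 0
  then show ?thesis by (simp add: pmf_eq_0_set_pmf)
next
  case (Suc j)
  then show ?thesis by (simp add: pmf_map_inj')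
qed

text \<open>The sum runs over finitely many point masses, and its range depends on \<open>x\<close>
  alone, not on the distribution. Convergence of each point mass therefore gives convergence of the
  distribution functions at every point.\<close>

lemma cdf_distr_real:
  fixes f :: "'a \<Rightarrow> nat"
  shows "cdf (distr (measure_pmf p) borel (\<lambda>x. real (f x))) x
    = (if x < 0 then 0 else \<Sum>k\<le>nat \<lfloor>x\<rfloor>. measure_pmf.prob p {y. f y = k})"
proof -
  have "cdf (distr (measure_pmf p) borel (\<lambda>x. real (f x))) x = measure_pmf.prob p {y. real (f y) \<le> x}"
    by (simp add: cdf_def measure_distr vimage_def)
  also have "\<dots> = (if x < 0 then 0 else \<Sum>k\<le>nat \<lfloor>x\<rfloor>. measure_pmf.prob p {y. f y = k})"
  proof (cases "x < 0")
    case True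
    then have "{y. real (f y) \<le> x} = {}" using of_nat_0_le_iff order_trans not_less by fastforce
    then show ?thesis using True by simp
  next
    case False
    then have "{y. real (f y) \<le> x} = f -` {..nat \<lfloor>x\<rfloor>}"
      by (auto simp: le_nat_iff le_floor_iff)
    then have "measure_pmf.prob p {y. real (f y) \<le> x} = measure_pmf.prob (map_pmf f p) {..nat \<lfloor>x\<rfloor>}"
      by simp
    also have "\<dots> = (\<Sum>k\<le>nat \<lfloor>x\<rfloor>. pmf (map_pmf f p) k)"
      by (rule measure_measure_pmf_finite) simp
    finally show ?thesis using False by (simp add: pmf_map vimage_def)
  qed
  finally show ?thesis .
qed

theorem theorem5:
  "weak_conv_m
     (\<lambda>n. distr (measure_pmf (random_rooted_map n)) borel (\<lambda>X. real (class_isthmic_parts X)))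
     (distr (measure_pmf (map_pmf Suc (geometric_pmf (1 / 2)))) borel real)"
proof -
  have "(\<lambda>n. measure_pmf.prob (random_rooted_map n) {X. class_isthmic_parts X = k})
      \<longlonglongrightarrow> measure_pmf.prob (map_pmf Suc (geometric_pmf (1 / 2))) {j. j = k}" for k
    using map_count_ratio[of k] pmf_shifted_geometric[of k]
    by (simp only: prob_isthmic_parts[of _ "\<lambda>c. c = k"] singleton_conv measure_pmf_single)
  then show ?thesis
    unfolding weak_conv_m_def weak_conv_def cdf_distr_real
    by (auto intro!: tendsto_sum)
qed

end
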